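(* Let $N$ be a positive integer and let $D$ be a positive divisor of $N$. Then the normalizer of $\Gamma_{0,1}(N,D)=\Gamma_0(N)\cap\Gamma_1(D)$ in $SL_2(\mathbb{R})$ is precisely $\Gamma_0^{*,\sigma}(N)$ for $$\sigma=\gcd\Big\{2D,\frac{N}{D}\Big\}\cdot\frac{\gcd\{s_N,24\}}{2^{\theta}\gcd\{s_N,24,2D\}},$$ where $\theta=1$ if $2v_2(D)=v_2(N)-1$ and $\theta=0$ otherwise.
   Context: For a positive integer $M$, write uniquely $M=s_M^2t_M$ with $s_M,t_M$ positive integers and $t_M$ square-free; $v_p(M)$ is the $p$-adic valuation of $M$. A positive divisor $\mu$ of $N$ is exact if $\gcd(\mu,N/\mu)=1$. $\Gamma_0^{*,s_N}(N)$ is the set of $A\in SL_2(\mathbb{R})$ admitting a presentation $A=\begin{pmatrix} a\sqrt{\mu} & b/\sqrt{\mu}\\ c\frac{N}{\mu}\sqrt{\mu} & d\sqrt{\mu}\end{pmatrix}$ with $\mu$ an exact divisor of $N$, $a,d\in\frac{1}{s_\mu}\mathbb{Z}$ and $b,c\in\frac{1}{s_{N/\mu}}\mathbb{Z}$. A presentation is cancelation-free if in each of the products $ab,ac,bd,cd$ of rational numbers in lowest terms no cancelation occurs (the denominator of the product is the product of the denominators); every element of $\Gamma_0^{*,s_N}(N)$ has such a presentation. For a positive divisor $\sigma$ of $s_N$, $\Gamma_0^{*,\sigma}(N)$ is the set of $A\in\Gamma_0^{*,s_N}(N)$ such that in a cancelation-free presentation $a,b,c,d\in\frac{1}{\sigma}\mathbb{Z}$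 (equivalently, $\sigma ab,\sigma cd\in\mathbb{Z}$ in any presentation). $\Gamma_0(N)$ is the group of matrices in $SL_2(\mathbb{Z})$ with lower left entry divisible by $N$; $\Gamma_1(D)$ is the subgroup of $\Gamma_0(D)$ of matrices whose diagonal entries are congruent to $1$ modulo $D$. *)

theory Defs
  imports
    "HOL-Analysis.Analysis"
    "HOL-Algebra.Group_Action"
    "HOL-Computational_Algebra.Squarefree"
begin

definition SL2R :: "(real^2^2) monoid" where
  "SL2R = \<lparr>carrier = {A. det A = 1}, mult = (**), one = mat 1\<rparr>"

lemma group_SL2R: "group SL2R"
proof (rule groupI)
  fix A assume "A \<in> carrier SL2R"
  then have d: "det A = 1" by (simp add: SL2R_def)
  then obtain B where B: "A ** B = mat 1" "B ** A = mat 1"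
    unfolding invertible_det_nz[symmetric] invertible_def
    by (metis invertible_def invertible_det_nz zero_neq_one)
  then have "det B = 1" by (metis d det_I det_mul mult_1)
  with B show "\<exists>B\<in>carrier SL2R. B \<otimes>\<^bsub>SL2R\<^esub> A = \<one>\<^bsub>SL2R\<^esub>"
    by (auto simp: SL2R_def)
qed (auto simp: SL2R_def det_mul matrix_mul_assoc)

definition Gamma0 :: "nat \<Rightarrow> (int^2^2) set" where
  "Gamma0 N = {A. det A = 1 \<and> int N dvd A $ 2 $ 1}"

definition Gamma1 :: "nat \<Rightarrow> (int^2^2) set" where
  "Gamma1 D = {A \<in> Gamma0 D. int D dvd A $ 1 $ 1 - 1 \<and> int D dvd A $ 2 $ 2 - 1}"

definition Gamma01 :: "nat \<Rightarrow> nat \<Rightarrow> (real^2^2) set" where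
  "Gamma01 N D = map_matrix real_of_int ` (Gamma0 N \<inter> Gamma1 D)"

lemma Gamma01_subset: "Gamma01 N D \<subseteq> carrier SL2R"
proof
  fix A assume "A \<in> Gamma01 N D"
  then obtain B :: "int^2^2" where "det B = 1" "A = map_matrix real_of_int B"
    by (auto simp: Gamma01_def Gamma0_def)
  moreover have "det (map_matrix real_of_int B) = real_of_int (det B)"
    by (simp add: det_2)
  ultimately show "A \<in> carrier SL2R" by (simp add: SL2R_def)
qed

lemma normalizer_Gamma01:
  "normalizer SL2R (Gamma01 N D) =
     {A \<in> carrier SL2R. A <#\<^bsub>SL2R\<^esub> Gamma01 N D #>\<^bsub>SL2R\<^esub> (inv\<^bsub>SL2R\<^esub> A) = Gamma01 N D}"
  using Gamma01_subset by (simp add: normalizer_def stabilizer_def)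

text \<open>The positive integer \<open>s\<^sub>M\<close> in \<open>M = s\<^sub>M\<^sup>2 t\<^sub>M\<close>, \<open>t\<^sub>M\<close> square-free, is
  \<^term>\<open>square_part M\<close>.\<close>

lemma square_part_eqI:
  fixes M s t :: nat
  assumes "s > 0" "squarefree t" "M = s\<^sup>2 * t"
  shows "square_part M = s"
proof (rule dvd_antisym)
  have "x dvd s" if "x\<^sup>2 dvd M" for x
  proof -
    have t0: "t \<noteq> 0" using assms(2) by (metis not_squarefree_0)
    show ?thesis
    proof (cases "x = 0")
      case True
      with that assms t0 show ?thesis by simp
    next
      case x: False
      have "multiplicity p x \<le> multiplicity p s" if p: "prime p" for p
      proof -
        have "multiplicity p (x\<^sup>2) \<le> multiplicity p (s\<^sup>2 * t)"
          using \<open>x\<^sup>2 dvd M\<close> assms t0 by (intro dvd_imp_multiplicity_le) auto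
        moreover have "multiplicity p t \<le> 1"
        proof (rule ccontr)
          assume "\<not> multiplicity p t \<le> 1"
          then have "p\<^sup>2 dvd t" by (intro multiplicity_dvd') simp
          with assms(2) have "p dvd 1" by (rule squarefreeD)
          with p show False by (simp add: prime_nat_iff)
        qed
        ultimately show ?thesis using p assms t0 x
          by (simp add: prime_elem_multiplicity_mult_distrib prime_elem_multiplicity_power_distrib)
      qed
      then show ?thesis using x assms(1) by (intro multiplicity_le_imp_dvd) auto
    qed
  qed
  then show "square_part M dvd s" by simp
  show "s dvd square_part M" using assms by (simp add: dvd_square_part_iff)
qed

text \<open>\<open>(1/n)\<int>\<close>\<close>

definition frac_Ints :: "nat \<Rightarrow> rat set" where
  "frac_Ints n = range (\<lambda>k::int. of_int k / of_nat n)"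

definition denom :: "rat \<Rightarrow> int" where
  "denom q = snd (quotient_of q)"

definition presentation ::
    "nat \<Rightarrow> real^2^2 \<Rightarrow> nat \<Rightarrow> rat \<Rightarrow> rat \<Rightarrow> rat \<Rightarrow> rat \<Rightarrow> bool" where
  "presentation N A \<mu> a b c d \<longleftrightarrow>
     \<mu> > 0 \<and> \<mu> dvd N \<and> coprime \<mu> (N div \<mu>) \<and>
     a \<in> frac_Ints (square_part \<mu>) \<and> d \<in> frac_Ints (square_part \<mu>) \<and>
     b \<in> frac_Ints (square_part (N div \<mu>)) \<and> c \<in> frac_Ints (square_part (N div \<mu>)) \<and>
     A = vector [vector [of_rat a * sqrt (real \<mu>), of_rat b / sqrt (real \<mu>)],
                 vector [of_rat c * (real N / real \<mu>) * sqrt (real \<mu>), of_rat d * sqrt (real \<mu>)]]"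

definition no_cancelation :: "rat \<Rightarrow> rat \<Rightarrow> bool" where
  "no_cancelation x y \<longleftrightarrow> denom (x * y) = denom x * denom y"

definition cancelation_free :: "rat \<Rightarrow> rat \<Rightarrow> rat \<Rightarrow> rat \<Rightarrow> bool" where
  "cancelation_free a b c d \<longleftrightarrow>
     no_cancelation a b \<and> no_cancelation a c \<and> no_cancelation b d \<and> no_cancelation c d"

text \<open>\<open>Gamma0_star_full N\<close> is \<open>\<Gamma>\<^sub>0\<^sup>*\<^sup>,\<^sup>\<sigma>(N)\<close> for \<open>\<sigma> = s\<^sub>N\<close>. In \<open>Gamma0_star\<close> the choice of the
  cancelation-free presentation is immaterial: \<open>ab\<close> and \<open>cd\<close> depend only on \<open>A\<close>, and the
  denominators of \<open>a, b, c, d\<close> all divide \<open>\<sigma>\<close> if and only if those of \<open>ab, cd\<close> do.\<close>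

definition Gamma0_star_full :: "nat \<Rightarrow> (real^2^2) set" where
  "Gamma0_star_full N = {A \<in> carrier SL2R. \<exists>\<mu> a b c d. presentation N A \<mu> a b c d}"

definition Gamma0_star :: "nat \<Rightarrow> nat \<Rightarrow> (real^2^2) set" where
  "Gamma0_star N \<sigma> = {A \<in> Gamma0_star_full N. \<exists>\<mu> a b c d.
     presentation N A \<mu> a b c d \<and> cancelation_free a b c d \<and> {a, b, c, d} \<subseteq> frac_Ints \<sigma>}"

text \<open>The condition \<open>2 v\<^sub>2(D) = v\<^sub>2(N) - 1\<close> is written without subtraction, which on
  \<^typ>\<open>nat\<close> would truncate for odd \<open>N\<close>.\<close>

definition theta :: "nat \<Rightarrow> nat \<Rightarrow> nat" where
  "theta N D = (if 2 * multiplicity 2 D + 1 = multiplicity 2 N then 1 else 0)"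

definition star_sigma :: "nat \<Rightarrow> nat \<Rightarrow> nat" where
  "star_sigma N D =
     (gcd (2 * D) (N div D) * gcd (square_part N) 24)
       div (2 ^ theta N D * gcd (gcd (square_part N) 24) (2 * D))"

text \<open>The division defining \<^const>\<open>star_sigma\<close> is exact, and the result is a divisor of \<open>s\<^sub>N\<close>.\<close>

lemma sigma_aux:
  fixes N D :: nat
  assumes "N > 0" "D dvd N"
  shows "2 ^ theta N D * gcd (gcd (square_part N) 24) (2 * D)
           dvd gcd (2 * D) (N div D) * gcd (square_part N) 24"
proof (rule mult_dvd_mono)
  obtain E where E: "N = D * E" using assms by blast
  with assms have pos: "D > 0" "E > 0" by auto
  show "2 ^ theta N D dvd gcd (2 * D) (N div D)"
  proof (cases "theta N D = 0")
    case False
    then have "2 * multiplicity 2 D + 1 = multiplicity 2 D + multiplicity 2 E"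
      using pos by (simp add: theta_def E prime_elem_multiplicity_mult_distrib split: if_splits)
    then have "multiplicity 2 E > 0" by simp
    then have "2 dvd E" by (metis not_dvd_imp_multiplicity_0 less_irrefl)
    moreover have "theta N D = 1" using False by (simp add: theta_def split: if_splits)
    ultimately show ?thesis using E pos by simp
  qed simp
qed (rule gcd_dvd1)

lemma real_sigma:
  assumes "N > 0" "D dvd N"
  shows "real (star_sigma N D) = real (gcd (2 * D) (N div D)) *
    (real (gcd (square_part N) 24) / (2 ^ theta N D * real (gcd (gcd (square_part N) 24) (2 * D))))"
  using real_of_nat_div[OF sigma_aux[OF assms]] by (simp add: star_sigma_def)

lemma sigma_dvd:
  assumes "N > 0" "D dvd N"
  shows "star_sigma N D dvd square_part N"
proof -
  obtain E where E: "N = D * E" using assms by blast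
  with assms have pos: "D > 0" "E > 0" by auto
  define s where "s = square_part N"
  have s: "s > 0" using assms(1) by (metis s_def gr0I not_less0 square_part_0_iff)
  define K where "K = 2 ^ theta N D * gcd (gcd s 24) (2 * D)"
  have K: "K > 0" using s by (simp add: K_def)
  have "gcd (2 * D) E * gcd s 24 dvd s * K"
  proof (rule multiplicity_le_imp_dvd)
    show "gcd (2 * D) E * gcd s 24 \<noteq> 0" using pos s by simp
    fix p :: nat assume p: "prime p"
    define vD vE vs where "vD = multiplicity p D" and "vE = multiplicity p E"
      and "vs = multiplicity p s"
    have vN: "multiplicity p N = vD + vE"
      using p pos by (simp add: E vD_def vE_def prime_elem_multiplicity_mult_distrib)
    have vs: "vs = (vD + vE) div 2"
      using p by (simp add: vs_def s_def prime_multiplicity_square_part vN)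
    have v2D: "multiplicity p (2 * D) = multiplicity p 2 + vD"
      using p pos by (simp add: vD_def prime_elem_multiplicity_mult_distrib)
    have "multiplicity p (2 ^ 3 * 3) = multiplicity p (2 ^ 3) + multiplicity p 3"
      using p by (intro prime_elem_multiplicity_mult_distrib) auto
    also have "multiplicity p (2 ^ 3) = 3 * multiplicity p 2"
      using p by (intro prime_elem_multiplicity_power_distrib) auto
    finally have v24: "multiplicity p 24 = 3 * multiplicity p 2 + multiplicity p 3" by simp
    have lhs: "multiplicity p (gcd (2 * D) E * gcd s 24) =
        min (multiplicity p 2 + vD) vE + min vs (multiplicity p 24)"
      using p pos s
      by (simp add: prime_elem_multiplicity_mult_distrib multiplicity_gcd v2D vE_def vs_def)
    have rhs: "multiplicity p (s * K) = vs + (theta N D * multiplicity p 2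
        + min (min vs (multiplicity p 24)) (multiplicity p 2 + vD))"
      using p pos s
      by (simp add: K_def prime_elem_multiplicity_mult_distrib multiplicity_gcd v2D vs_def
          prime_elem_multiplicity_power_distrib)
    show "multiplicity p (gcd (2 * D) E * gcd s 24) \<le> multiplicity p (s * K)"
    proof (cases "p = 2")
      case True
      have "multiplicity 2 (3::nat) = 0" by (rule not_dvd_imp_multiplicity_0) simp
      moreover have "multiplicity 2 (2::nat) = 1" by simp
      moreover have "theta N D = (if 2 * vD + 1 = vD + vE then 1 else 0)"
        using True vN by (simp add: theta_def vD_def)
      ultimately show ?thesis
        unfolding lhs rhs v24 using vs True by (auto simp: min_def)
    next
      case False
      have "multiplicity p 2 = 0" using p False
        by (intro not_dvd_imp_multiplicity_0) (auto dest: primes_dvd_imp_eq[OF p two_is_prime_nat])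
      moreover have "multiplicity p 3 \<le> 1"
        using p by (cases "p = 3") (auto intro!: eq_imp_le not_dvd_imp_multiplicity_0
            simp: prime_multiplicity_other)
      ultimately show ?thesis
        unfolding lhs rhs v24 using vs by (auto simp: min_def)
    qed
  qed
  moreover have "gcd (2 * D) E * gcd s 24 = star_sigma N D * K"
    using sigma_aux[OF assms] pos by (simp add: star_sigma_def K_def s_def E)
  ultimately show ?thesis using K by (simp add: s_def)
qed

end

(*
A matrix of the normalizer conjugates (1,1;0,1) and (1,0;N,1) into Gamma_{0,1}(N,D), and the
integrality of the resulting entries forces the form
  A = (x sqrt g, z/(s sqrt g); w s h sqrt g, y sqrt g),  g h = t_N,  s = s_N,  xyg - zwh = 1,
which is exactly the shape of the elements of Gamma_0^{*,s_N}(N); in these coordinates membership in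
Gamma_0^{*,sigma}(N) means that s divides sigma xz and sigma wy.  Conjugating (k,l;Nm,n) by such a
matrix shows that A normalizes the group iff, for each c among xz, wy, yz, wx, s divides (k - n)c for
all admissible k, n, and D divides s t_N c.  Together with N, the k - n generate the ideal
of gcd(N, lcm(24, 2D)): one inclusion because k^2 = 1 modulo every divisor of 24 prime to k, the other
prime by prime.  A comparison of valuations identifies the two conditions with s | sigma c.
*)

theory Submission
  imports Defs "HOL-Computational_Algebra.Nth_Powers" "HOL-Number_Theory.Cong"
begin

text \<open>Only squares and products of the real entries of a normalizing matrix are known to be
  integers. The square roots are controlled because (\<alpha>\<delta>)^2 and (\<beta>\<gamma>)^2
  turn out to be squares of consecutive integers, hence coprime: this forces the radicals on the
  diagonal to agree and t_N to split as g h. For inverse units k, n modulo N, k (k - n) is k^2 - 1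
  modulo N. So 24 enters as the largest modulus all of whose units square to 1, and the 2 of 2D
  enters because k^2 - 1 = (k - 1)(k + 1) with k + 1 even when N is even. The condition D | s t_N c
  comes from the diagonal entries modulo D. Since N = s (s t_N), it says s | (N/D) c. Both
  conditions together are s | gcd(lcm(24, 2D), N/D) c, and sigma is the gcd of that number with s.
  The factor 2^theta makes sigma a divisor of s: if theta = 1, the exponent of 2 in gcd(2D, N/D)
  exceeds that in s by one.\<close>

section \<open>Differences of inverse units modulo N\<close>

lemma dvd_square_minus_one:
  fixes m k :: int
  assumes "m dvd 24" "coprime k m"
  shows "m dvd k\<^sup>2 - 1"
proof -
  have 8: "8 dvd k\<^sup>2 - 1" if "even m"
  proof -
    have "odd k" using assms(2) that by (metis coprime_common_divisor odd_one)
    then obtain j where j: "k = 2 * j + 1" by (elim oddE)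
    have "even (j * (j + 1))" by simp
    then obtain i where "j * (j + 1) = 2 * i" by blast
    then have "k\<^sup>2 - 1 = 8 * i" by (simp add: j power2_eq_square algebra_simps)
    then show ?thesis by simp
  qed
  have 3: "3 dvd k\<^sup>2 - 1" if "3 dvd m"
  proof -
    have "\<not> 3 dvd k" using assms(2) that coprime_common_divisor[of k m 3] by auto
    then have "\<exists>j. k = 3 * j + 1 \<or> k = 3 * j + 2" by presburger
    then obtain j where "k = 3 * j + 1 \<or> k = 3 * j + 2" by blast
    then have "k\<^sup>2 - 1 = 3 * (3 * j * j + 2 * j) \<or> k\<^sup>2 - 1 = 3 * (3 * j * j + 4 * j + 1)"
      by (auto simp: power2_eq_square algebra_simps)
    then show ?thesis by (metis dvd_triv_left)
  qed
  have c8: "coprime m 8" if "odd m"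
  proof -
    have "coprime m (2 ^ 3)" using that by (metis coprime_power_right_iff coprime_right_2_iff_odd)
    then show ?thesis by simp
  qed
  have c3: "coprime m 3" if "\<not> 3 dvd m"
    using prime_imp_coprime[of "3::int" m] that by (simp add: coprime_commute)
  have 24: "m dvd 8 * 3" using assms(1) by simp
  show ?thesis
  proof (cases "even m"; cases "3 dvd m")
    assume "even m" "3 dvd m"
    moreover have "coprime (8::int) 3" by (simp add: coprime_iff_gcd_eq_1 gcd_non_0_int)
    ultimately have "8 * 3 dvd k\<^sup>2 - 1" using 8 3 by (intro divides_mult) auto
    then show ?thesis using 24 dvd_trans by blast
  next
    assume "even m" "\<not> 3 dvd m"
    then show ?thesis using 24 8 c3 coprime_dvd_mult_left_iff dvd_trans by blast
  next
    assume "odd m" "3 dvd m"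
    then show ?thesis using 24 3 c8 coprime_dvd_mult_right_iff dvd_trans by blast
  next
    assume "odd m" "\<not> 3 dvd m"
    then show ?thesis using 24 c3 c8 by (metis coprime_dvd_mult_left_iff coprime_common_divisor
          dvd_refl unit_imp_dvd)
  qed
qed

text \<open>The witness \<open>\<kappa>\<close> makes \<open>\<kappa>\<^sup>2 - 1\<close> as little divisible by \<open>p\<close> as \<open>\<kappa> \<equiv> 1\<close> modulo the
  \<open>p\<close>-part of \<open>D\<close> permits; the Chinese remainder theorem then lifts it to a unit modulo \<open>N\<close>.\<close>

lemma ex_unit_square_minus_one:
  fixes D p :: nat
  assumes p: "prime p" and "D > 0"
  obtains \<kappa> q r :: int where "\<kappa>\<^sup>2 - 1 = q * r" "q dvd int (lcm 24 (2 * D))" "coprime r (int p)"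
    "coprime \<kappa> (int p)" "int (p ^ multiplicity p D) dvd \<kappa> - 1"
proof (cases "p dvd D")
  case False
  then have m: "multiplicity p D = 0" by (rule not_dvd_imp_multiplicity_0)
  have L: "(24::int) dvd int (lcm 24 (2 * D))" by (metis dvd_lcm1 int_dvd_int_iff of_nat_numeral)
  \<comment> \<open>No congruence constrains \<open>\<kappa>\<close> here: 3 serves p = 2 (9 - 1 =
    8), and 2 serves every odd p (4 - 1 = 3).\<close>
  show ?thesis
  proof (cases "p = 2")
    case True
    have "(8::int) dvd int (lcm 24 (2 * D))" by (rule dvd_trans[OF _ L]) simp
    then show ?thesis using that[of 3 8 1] m True by simp
  next
    case False
    have "(3::int) dvd int (lcm 24 (2 * D))" by (rule dvd_trans[OF _ L]) simp
    moreover have "odd p" using False prime_ge_2_nat[OF p] by (intro prime_odd_nat[OF p]) simp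
    ultimately show ?thesis using that[of 2 3 1] m False by simp
  qed
next
  case True
  define d where "d = multiplicity p D"
  have d: "d > 0" using True assms by (simp add: d_def prime_multiplicity_gt_zero_iff)
  then obtain d' where d': "d = Suc d'" by (cases d) auto
  have "p ^ d dvd D" by (simp add: d_def multiplicity_dvd)
  then have "2 * p ^ d dvd 2 * D" by simp
  then have "2 * p ^ d dvd lcm 24 (2 * D)" by (rule dvd_trans) simp
  then have L2: "2 * int p ^ d dvd int (lcm 24 (2 * D))"
    by (metis int_dvd_int_iff of_nat_mult of_nat_numeral of_nat_power)
  then have L: "int p ^ d dvd int (lcm 24 (2 * D))" by (rule dvd_mult_right)
  have cop_iff: "coprime (a + int p ^ Suc i) (int p) \<longleftrightarrow> coprime a (int p)" for a i
  proof -
    have "gcd (int p) (a + int p ^ Suc i) = gcd (int p) a"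
      using gcd_add_mult[of "int p" "int p ^ i" a] by (simp add: ac_simps)
    then show ?thesis by (metis coprime_iff_gcd_eq_1 gcd.commute)
  qed
  have cop: "coprime (1 + int p ^ d) (int p)" unfolding d' by (simp only: cop_iff coprime_1_left)
  show ?thesis
  proof (cases "p = 2")
    case False
    then have "odd p" using False prime_ge_2_nat[OF p] by (intro prime_odd_nat[OF p]) simp
    then have "coprime (2 + int p ^ d) (int p)"
      unfolding d' cop_iff by simp
    moreover have "(1 + int p ^ d)\<^sup>2 - 1 = int p ^ d * (2 + int p ^ d)"
      by (simp add: power2_eq_square algebra_simps)
    ultimately show ?thesis
      using that[of "1 + int p ^ d" "int p ^ d" "2 + int p ^ d"] L cop
      by (simp add: d_def)
  next
    case p2: True
    show ?thesis
    \<comment> \<open>For p = 2 the cofactor \<open>2 + p ^ d\<close> is even, so one more 2 moves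
      into \<open>q\<close>; this is what 2D rather than D provides. The remaining cofactor
      \<open>1 + 2 ^ d'\<close> is odd unless d = 1; there \<open>\<kappa> = 3\<close> gives 8, a
      divisor of 24.\<close>
    proof (cases "d' = 0")
      case True
      have "(24::int) dvd int (lcm 24 (2 * D))" by (metis dvd_lcm1 int_dvd_int_iff of_nat_numeral)
      then have "(8::int) dvd int (lcm 24 (2 * D))" by (rule dvd_trans[rotated]) simp
      then show ?thesis using that[of 3 8 1] p2 True d' by (simp add: d_def)
    next
      case False
      have "(1 + int p ^ d)\<^sup>2 - 1 = (2 * int p ^ d) * (1 + int p ^ d')"
        by (simp add: p2 d' power2_eq_square algebra_simps)
      moreover have "coprime (1 + int p ^ d') (int p)" using False p2 by simp
      ultimately show ?thesis
        using that[of "1 + int p ^ d" "2 * int p ^ d" "1 + int p ^ d'"] L2 cop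
        by (simp add: d_def)
    qed
  qed
qed

lemma dvd_if_prime_powers_dvd:
  fixes s :: nat and c :: int
  assumes "s > 0" "\<And>p. prime p \<Longrightarrow> int (p ^ multiplicity p s) dvd c"
  shows "int s dvd c"
proof (cases "c = 0")
  case False
  have "s dvd nat \<bar>c\<bar>"
  proof (rule multiplicity_le_imp_dvd)
    show "s \<noteq> 0" using assms(1) by simp
    fix p :: nat assume p: "prime p"
    from assms(2)[OF p] have "p ^ multiplicity p s dvd nat \<bar>c\<bar>"
      by (simp add: nat_abs_dvd_iff int_dvd_int_iff flip: int_dvd_int_iff)
    then show "multiplicity p s \<le> multiplicity p (nat \<bar>c\<bar>)"
      using p False by (intro multiplicity_geI) (auto simp: prime_nat_iff)
  qed
  then show ?thesis by (simp flip: int_dvd_int_iff)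
qed simp

text \<open>Multiplying by the unit \<open>k\<close> turns \<open>k - n\<close> into
  \<open>k\<^sup>2 - 1\<close> modulo \<open>N\<close>, and \<open>s\<close> divides
  \<open>N\<close>. The left side thus asks how divisible all the \<open>k\<^sup>2 - 1\<close> are:
  one suitable \<open>k\<close> per prime bounds this from above, and the identities for squares of
  units from below.\<close>

lemma dvd_unit_minus_inverse_iff:
  fixes N D s :: nat and c :: int
  assumes "N > 0" "D dvd N" "s dvd N"
  shows "(\<forall>k n. int N dvd k * n - 1 \<longrightarrow> int D dvd k - 1 \<longrightarrow> int D dvd n - 1 \<longrightarrow> int s dvd (k - n) * c)
    \<longleftrightarrow> int s dvd int (lcm 24 (2 * D)) * c" (is "?l \<longleftrightarrow> ?r")
proof
  have D: "D > 0" and s: "s > 0" using assms by (auto intro!: gr0I)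
  assume l: ?l
  show ?r
  proof (rule dvd_if_prime_powers_dvd[OF s])
    fix p :: nat assume p: "prime p"
    obtain \<kappa> q r :: int where \<kappa>: "\<kappa>\<^sup>2 - 1 = q * r" "q dvd int (lcm 24 (2 * D))"
      "coprime r (int p)" "coprime \<kappa> (int p)" "int (p ^ multiplicity p D) dvd \<kappa> - 1"
      by (rule ex_unit_square_minus_one[OF p D])
    define e where "e = multiplicity p N"
    obtain N' where N': "N = p ^ e * N'" "\<not> p dvd N'"
      using multiplicity_decompose'[of N p] p assms(1)
      by (metis e_def gr_implies_not0 not_prime_unit)
    obtain D' where D': "D = p ^ multiplicity p D * D'" "\<not> p dvd D'"
      using multiplicity_decompose'[of D p] p D
      by (metis gr_implies_not0 not_prime_unit)
    have cop: "coprime (int (p ^ e)) (int N')" using N'(2) p by (simp add: prime_imp_coprime)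
    \<comment> \<open>Taking k = 1 away from p settles the congruence modulo \<open>D'\<close>; the
      p-part of D is handled by \<open>\<kappa>\<close>.\<close>
    obtain k where k: "[k = \<kappa>] (mod int (p ^ e))" "[k = 1] (mod int N')"
      using binary_chinese_remainder_int[OF cop] by blast
    have "coprime k (int (p ^ e))" using k(1) \<kappa>(4)
      by (metis cong_imp_coprime cong_sym coprime_power_right_iff of_nat_power)
    moreover have "coprime k (int N')" using k(2) by (metis cong_imp_coprime cong_sym coprime_1_left)
    ultimately have "coprime k (int N)" by (simp add: N'(1))
    then obtain n where n: "[k * n = 1] (mod int N)" using cong_solve_coprime_int by blast
    have kn: "int N dvd k * n - 1" using n by (simp add: cong_iff_dvd_diff)
    have "D' dvd N" using D' assms(2) by (metis dvd_mult_right)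
    moreover have "coprime D' (p ^ e)" using D'(2) p
      by (metis coprime_commute coprime_power_left_iff prime_imp_coprime)
    ultimately have "D' dvd N'" by (simp add: N'(1) coprime_dvd_mult_right_iff)
    then have "int D' dvd k - 1" using k(2) by (meson cong_iff_dvd_diff dvd_trans int_dvd_int_iff)
    moreover have "multiplicity p D \<le> e"
      unfolding e_def using assms by (intro dvd_imp_multiplicity_le) auto
    then have "int (p ^ multiplicity p D) dvd int (p ^ e)" by (simp add: le_imp_power_dvd)
    then have "int (p ^ multiplicity p D) dvd k - \<kappa>"
      using k(1) by (meson cong_iff_dvd_diff dvd_trans)
    then have "int (p ^ multiplicity p D) dvd k - 1"
      using dvd_add[OF _ \<kappa>(5), of "k - \<kappa>"] by simp
    moreover have "coprime (int (p ^ multiplicity p D)) (int D')"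
      using D'(2) p by (simp add: prime_imp_coprime)
    ultimately have Dk: "int D dvd k - 1"
      by (subst D'(1)) (simp add: divides_mult)
    have "int D dvd int N" using assms(2) by simp
    then have "int D dvd k * n - 1" using kn dvd_trans by blast
    then have "int D dvd (k * n - 1) - (k - 1) * n" using dvd_mult2[OF Dk] by (rule dvd_diff)
    moreover have "(k * n - 1) - (k - 1) * n = n - 1" by (simp add: algebra_simps)
    ultimately have "int D dvd n - 1" by simp
    with l kn Dk have "int s dvd (k - n) * c" by blast
    then have "int s dvd ((k - n) * c) * k" by (rule dvd_mult2)
    moreover have "int s dvd (k * n - 1) * c"
      using kn assms(3) by (meson dvd_mult2 dvd_trans int_dvd_int_iff)
    ultimately have "int s dvd ((k - n) * c) * k + (k * n - 1) * c" by (rule dvd_add)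
    then have sk: "int s dvd (k\<^sup>2 - 1) * c" by (simp add: algebra_simps power2_eq_square)
    \<comment> \<open>Since \<open>v \<le> e\<close>, \<open>k\<close> may be replaced by
      \<open>\<kappa>\<close> modulo \<open>p ^ v\<close>. The factor \<open>r\<close> of
      \<open>\<kappa>\<^sup>2 - 1\<close> is prime to p and cancels, leaving
      \<open>q\<close>.\<close>
    define v where "v = multiplicity p s"
    have "int (p ^ v) dvd int s" unfolding v_def by (simp only: int_dvd_int_iff multiplicity_dvd)
    then have 1: "int (p ^ v) dvd (k\<^sup>2 - 1) * c" using sk dvd_trans by blast
    have "v \<le> e"
      unfolding e_def v_def using assms by (intro dvd_imp_multiplicity_le) auto
    then have "int (p ^ v) dvd int (p ^ e)" by (simp add: le_imp_power_dvd)
    then have "int (p ^ v) dvd k - \<kappa>" using k(1) by (meson cong_iff_dvd_diff dvd_trans)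
    then have "int (p ^ v) dvd (k - \<kappa>) * ((k + \<kappa>) * c)" by (rule dvd_mult2)
    with 1 have "int (p ^ v) dvd (k\<^sup>2 - 1) * c - (k - \<kappa>) * ((k + \<kappa>) * c)" by (rule dvd_diff)
    moreover have "(k\<^sup>2 - 1) * c - (k - \<kappa>) * ((k + \<kappa>) * c) = (\<kappa>\<^sup>2 - 1) * c"
      by (simp add: algebra_simps power2_eq_square)
    ultimately have "int (p ^ v) dvd r * (q * c)" by (simp add: \<kappa>(1) algebra_simps)
    moreover have "coprime (int (p ^ v)) r" using \<kappa>(3) by (simp add: coprime_commute)
    ultimately have "int (p ^ v) dvd q * c" by (simp add: coprime_dvd_mult_right_iff)
    then show "int (p ^ multiplicity p s) dvd int (lcm 24 (2 * D)) * c"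
      using \<kappa>(2) unfolding v_def by (meson dvd_refl dvd_trans mult_dvd_mono)
  qed
next
  assume r: ?r
  show ?l
  proof (intro allI impI)
    fix k n assume kn: "int N dvd k * n - 1" "int D dvd k - 1" "int D dvd n - 1"
    have cop: "coprime k (int N)"
    proof (rule coprimeI)
      fix x assume x: "x dvd k" "x dvd int N"
      then have "x dvd k * n - (k * n - 1)" using kn(1) by (meson dvd_diff dvd_mult2 dvd_trans)
      then show "is_unit x" by simp
    qed
    have "gcd (int N) 24 dvd k\<^sup>2 - 1"
      using cop by (intro dvd_square_minus_one) (auto intro: coprime_divisors[of k k _ "int N"])
    moreover have "gcd (int N) (2 * int D) dvd k\<^sup>2 - 1"
    proof (cases "even N")
      case True
      then have "odd k" using cop by (metis coprime_common_divisor even_of_nat odd_one)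
      then have "2 * int D dvd (k + 1) * (k - 1)" using kn(2) by (intro mult_dvd_mono) auto
      then have "2 * int D dvd k\<^sup>2 - 1" by (simp add: power2_eq_square algebra_simps)
      then show ?thesis by (meson dvd_trans gcd_dvd2)
    next
      case False
      then have "coprime (gcd (int N) (2 * int D)) 2"
        by (metis coprime_right_2_iff_odd dvd_trans even_of_nat gcd_dvd1)
      then have "gcd (int N) (2 * int D) dvd int D"
        using gcd_dvd2 coprime_dvd_mult_right_iff by blast
      then have "gcd (int N) (2 * int D) dvd (k - 1) * (k + 1)"
        using kn(2) by (meson dvd_mult2 dvd_trans)
      then show ?thesis by (simp add: power2_eq_square algebra_simps)
    qed
    ultimately have "lcm (gcd (int N) 24) (gcd (int N) (2 * int D)) dvd k\<^sup>2 - 1" by simp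
    then have "gcd (int N) (lcm 24 (2 * int D)) dvd k\<^sup>2 - 1" by (simp add: gcd_lcm_distrib)
    moreover have "gcd (int N) (lcm 24 (2 * int D)) dvd k * n - 1"
      using kn(1) by (meson dvd_trans gcd_dvd1)
    ultimately have "gcd (int N) (lcm 24 (2 * int D)) dvd (k\<^sup>2 - 1) - (k * n - 1)" by (rule dvd_diff)
    then have "gcd (int N) (lcm 24 (2 * int D)) dvd k * (k - n)"
      by (simp add: power2_eq_square algebra_simps)
    moreover have "coprime (gcd (int N) (lcm 24 (2 * int D))) k"
      using coprime_divisors[OF gcd_dvd1 dvd_refl] cop coprime_commute by blast
    ultimately have G: "gcd (int N) (lcm 24 (2 * int D)) dvd k - n"
      using coprime_dvd_mult_right_iff by blast
    have "int (lcm 24 (2 * D)) = lcm 24 (2 * int D)" by (simp flip: lcm_int_int_eq)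
    then have "int s dvd gcd (int N * c) (lcm 24 (2 * int D) * c)"
      using r assms(3) by (simp add: dvd_mult2)
    then have "int s dvd gcd (int N) (lcm 24 (2 * int D)) * c"
      by (simp add: gcd_mult_right gcd.commute)
    then show "int s dvd (k - n) * c" using G by (meson dvd_refl dvd_trans mult_dvd_mono)
  qed
qed

section \<open>Square classes and coprime factorizations\<close>

lemma squarefree_dvd_square_imp_dvd:
  fixes h q :: nat
  assumes "squarefree h" "h dvd q\<^sup>2"
  shows "h dvd q"
proof -
  have h0: "h \<noteq> 0" using assms(1) by (metis not_squarefree_0)
  obtain h' q' where h': "h = h' * gcd h q" "q = q' * gcd h q" "coprime h' q'"
    using gcd_coprime_exists[of h q] h0 by auto
  define d where "d = gcd h q"
  have d: "h = h' * d" "q = q' * d" "d > 0" using h' h0 by (auto simp: d_def)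
  have "h' * d dvd (q' * q' * d) * d" using assms(2) d by (simp add: power2_eq_square algebra_simps)
  then have "h' dvd q' * q' * d" using d(3) by simp
  then have "h' dvd d" using h'(3) by (simp add: coprime_dvd_mult_right_iff)
  then have "h'\<^sup>2 dvd h" using d by (simp add: power2_eq_square)
  then have "h' = 1" using assms(1) squarefreeD by fastforce
  then show ?thesis using d by simp
qed

text \<open>Removing \<open>g = gcd a t\<close> from \<open>a\<close> leaves \<open>a'\<close> prime
  to \<open>b * h\<close> with \<open>a' * (b * h)\<close> a square, so both are squares;
  \<open>h\<close> being square-free, \<open>b\<close> is then \<open>h\<close> times a square. This
  is where the splitting of the square-free part into \<open>g * h\<close> originates.\<close>

lemma coprime_mult_squarefree_eq_square:
  fixes a b t r :: nat
  assumes "coprime a b" "a * b * t = r\<^sup>2" "squarefree t"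
  obtains g h x y where "g * h = t" "a = g * x\<^sup>2" "b = h * y\<^sup>2"
proof -
  have t0: "t \<noteq> 0" using assms(3) by (metis not_squarefree_0)
  obtain a' h where ah: "a = a' * gcd a t" "t = h * gcd a t" "coprime a' h"
    using gcd_coprime_exists[of a t] t0 by auto
  define g where "g = gcd a t"
  have g: "a = a' * g" "t = h * g" "g > 0" using ah t0 by (auto simp: g_def)
  have eq: "g\<^sup>2 * (a' * (b * h)) = r\<^sup>2"
    using assms(2) unfolding g by (simp add: power2_eq_square algebra_simps)
  then have "g dvd r" by (metis dvd_triv_left pow_divides_pow_iff zero_less_numeral)
  then obtain r' where "r = g * r'" by blast
  with eq g(3) have eq': "a' * (b * h) = r'\<^sup>2" by (simp add: power_mult_distrib)
  have "coprime a' (b * h)" using assms(1) ah(3) g(1) by simp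
  moreover have "is_nth_power 2 (a' * (b * h))" by (simp add: eq')
  ultimately have "is_nth_power 2 a'" "is_nth_power 2 (b * h)"
    using is_nth_power_mult_coprime_nat_iff by blast+
  then obtain x q where xq: "a' = x\<^sup>2" "b * h = q\<^sup>2" by (auto simp: is_nth_power_def)
  have "squarefree h" using assms(3) g(2) squarefree_multD(1) by blast
  moreover have "h dvd q\<^sup>2" using xq(2) by (metis dvd_triv_right)
  ultimately obtain y where "q = h * y" using squarefree_dvd_square_imp_dvd by blast
  with xq(2) g(2) t0 have "b = h * y\<^sup>2" by (simp add: power2_eq_square)
  then show ?thesis using that[of g h x y] g xq by (simp add: mult.commute)
qed

text \<open>The factor \<open>m\<close> collects the full p-parts of \<open>N\<close> for the primes
  p dividing \<open>u\<close>; the induction strips off one such p-part at a time. It supplies the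
  exact divisor \<open>\<mu>\<close> of a cancelation-free presentation.\<close>

lemma ex_coprime_split:
  fixes N u :: nat
  assumes "N > 0"
  obtains m n where "N = m * n" "coprime m n" "coprime n u"
    "\<And>p. prime p \<Longrightarrow> p dvd m \<Longrightarrow> p dvd u"
proof -
  have "\<exists>m n. N = m * n \<and> coprime m n \<and> coprime n u \<and> (\<forall>p. prime p \<longrightarrow> p dvd m \<longrightarrow> p dvd u)"
    using assms
  proof (induction N rule: less_induct)
    case (less N)
    show ?case
    proof (cases "coprime N u")
      case True
      then show ?thesis by (intro exI[of _ 1] exI[of _ N]) auto
    next
      case False
      then obtain p where p: "prime p" "p dvd N" "p dvd u"
        by (metis coprime_iff_gcd_eq_1 gcd_dvd1 gcd_dvd2 dvd_trans prime_factor_nat)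
      obtain N' where N': "N = p ^ multiplicity p N * N'" "\<not> p dvd N'"
        using multiplicity_decompose'[of N p] p less.prems
        by (metis gr_implies_not0 not_prime_unit)
      have mp: "multiplicity p N > 0"
        using p less.prems by (simp add: prime_multiplicity_gt_zero_iff)
      have "N' > 0" using N' by (metis gr0I dvd_0_right)
      moreover have "1 < p ^ multiplicity p N"
        using mp p(1) by (intro one_less_power prime_gt_1_nat)
      then have "N' < N" using N'(1) \<open>N' > 0\<close>
        by (metis mult_1 mult_less_cancel2)
      ultimately obtain m n where mn: "N' = m * n" "coprime m n" "coprime n u"
          "\<forall>q. prime q \<longrightarrow> q dvd m \<longrightarrow> q dvd u" using less.IH by blast
      have "\<not> p dvd n" using N'(2) mn(1) by auto
      then have "coprime (p ^ multiplicity p N * m) n"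
        using p(1) mn(2) by (simp add: prime_imp_coprime)
      moreover have "q dvd u" if "prime q" "q dvd p ^ multiplicity p N * m" for q
        using that p mn(4) by (metis prime_dvd_mult_iff prime_dvd_power primes_dvd_imp_eq)
      ultimately show ?thesis using N'(1) mn
        by (intro exI[of _ "p ^ multiplicity p N * m"] exI[of _ n]) auto
    qed
  qed
  then show ?thesis using that by blast
qed

section \<open>Valuations of sigma\<close>

lemma multiplicity_2D_24:
  fixes p D :: nat
  assumes "prime p" "D > 0"
  shows "multiplicity p (2 * D) = (if p = 2 then 1 else 0) + multiplicity p D"
    and "multiplicity p 24 = (if p = 2 then 3 else if p = 3 then 1 else 0)"
proof -
  have two: "multiplicity p 2 = (if p = 2 then 1 else 0)"
    using assms(1) prime_multiplicity_other[OF assms(1) two_is_prime_nat] by auto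
  have three: "multiplicity p 3 = (if p = 3 then 1 else 0)"
    using assms(1) prime_multiplicity_other[OF assms(1), of 3] by auto
  show "multiplicity p (2 * D) = (if p = 2 then 1 else 0) + multiplicity p D"
    using assms two by (simp add: prime_elem_multiplicity_mult_distrib)
  have "multiplicity p (2 ^ 3 * 3) = multiplicity p (2 ^ 3) + multiplicity p 3"
    using assms(1) by (intro prime_elem_multiplicity_mult_distrib) auto
  also have "multiplicity p (2 ^ 3) = 3 * multiplicity p 2"
    using assms(1) by (intro prime_elem_multiplicity_power_distrib) auto
  finally show "multiplicity p 24 = (if p = 2 then 3 else if p = 3 then 1 else 0)"
    using two three by simp
qed

text \<open>Multiplied by \<open>s\<close>, the condition \<open>D dvd s * t * c\<close> becomes
  \<open>s dvd (N div D) * c\<close>, so all three conditions bound the exponent of each prime in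
  \<open>s\<close>. As that exponent is the floor of half of \<open>vD + vE\<close>, what remains is
  linear arithmetic with minima and maxima.\<close>

lemma dvd_star_sigma_mult_iff:
  fixes N D s t c :: nat
  assumes "N > 0" "D dvd N" "s = square_part N" "N = s\<^sup>2 * t"
  shows "s dvd star_sigma N D * c \<longleftrightarrow> s dvd lcm 24 (2 * D) * c \<and> D dvd s * t * c"
proof (cases "c = 0")
  case c: False
  define \<sigma> where "\<sigma> = star_sigma N D"
  obtain E where E: "N = D * E" using assms by blast
  have pos: "D > 0" "E > 0" "s > 0" "t > 0" using assms(1,4) E by (auto intro!: gr0I)
  have eq: "\<sigma> * (2 ^ theta N D * gcd (gcd s 24) (2 * D)) = gcd (2 * D) E * gcd s 24"
    using sigma_aux[OF assms(1,2)] pos by (simp add: \<sigma>_def star_sigma_def assms(3) E)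
  then have s0: "\<sigma> > 0" using pos by (metis gr0I mult_0 gcd_eq_0_iff mult_is_0 neq0_conv)
  have "multiplicity p s \<le> multiplicity p (\<sigma> * c) \<longleftrightarrow>
      multiplicity p s \<le> multiplicity p (lcm 24 (2 * D) * c) \<and>
      multiplicity p D \<le> multiplicity p (s * t * c)" if p: "prime p" for p
  proof -
    note dist = prime_elem_multiplicity_mult_distrib prime_elem_multiplicity_power_distrib
    note m = multiplicity_2D_24[OF p pos(1)]
    define vD vE vs vt v\<sigma> vc
      where v: "vD = multiplicity p D" "vE = multiplicity p E" "vs = multiplicity p s"
        "vt = multiplicity p t" "v\<sigma> = multiplicity p \<sigma>" "vc = multiplicity p c"
    have vN: "multiplicity p N = vD + vE"
      using p pos by (simp add: E v dist)
    have vs: "vs = (vD + vE) div 2"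
      using p by (simp add: v assms(3) prime_multiplicity_square_part vN[unfolded v])
    have vt: "vD + vE = 2 * vs + vt"
      using vN assms(4) p pos by (simp add: v dist)
    have vt1: "vt \<le> 1" using vs vt by presburger
    have "multiplicity p (2 ^ theta N D) = (if p = 2 then theta N D else 0)"
      using p prime_multiplicity_other[OF p two_is_prime_nat] by (auto simp: dist)
    then have v2: "multiplicity p (2 ^ theta N D) = (if p = 2 \<and> 2 * vD + 1 = vD + vE then 1 else 0)"
      using vN by (auto simp: theta_def v)
    have "multiplicity p (\<sigma> * (2 ^ theta N D * gcd (gcd s 24) (2 * D)))
        = multiplicity p (gcd (2 * D) E * gcd s 24)" by (simp only: eq)
    then have *: "v\<sigma> + ((if p = 2 \<and> 2 * vD + 1 = vD + vE then 1 else 0) +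
        min (min vs (multiplicity p 24)) (multiplicity p (2 * D)))
        = min (multiplicity p (2 * D)) vE + min vs (multiplicity p 24)"
      using p pos s0 by (simp add: dist multiplicity_gcd v v2[unfolded v])
    have **: "multiplicity p (\<sigma> * c) = v\<sigma> + vc"
        "multiplicity p (lcm 24 (2 * D) * c) = max (multiplicity p 24) (multiplicity p (2 * D)) + vc"
        "multiplicity p (s * t * c) = vs + vt + vc"
      using p pos s0 c by (simp_all add: dist multiplicity_lcm v)
    \<comment> \<open>Only at 2 and 3 does 24 have a positive exponent, and only at 2 do the factor
      in 2D and theta matter.\<close>
    consider "p = 2" | "p = 3" | "p \<noteq> 2" "p \<noteq> 3" by blast
    then show ?thesis
    proof cases
      case 1
      then have "vs \<le> v\<sigma> + vc \<longleftrightarrow> vs \<le> max 3 (1 + vD) + vc \<and> vD \<le> vs + vt + vc"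
        using * vt vt1 unfolding m[folded v] by (auto simp: min_def max_def split: if_splits)
      then show ?thesis unfolding ** m v(1,3)[symmetric] using 1 by simp
    next
      case 2
      then have "vs \<le> v\<sigma> + vc \<longleftrightarrow> vs \<le> max 1 vD + vc \<and> vD \<le> vs + vt + vc"
        using * vt vt1 unfolding m[folded v] by (auto simp: min_def max_def split: if_splits)
      then show ?thesis unfolding ** m v(1,3)[symmetric] using 2 by simp
    next
      case 3
      then have "vs \<le> v\<sigma> + vc \<longleftrightarrow> vs \<le> vD + vc \<and> vD \<le> vs + vt + vc"
        using * vt vt1 unfolding m[folded v] by (auto simp: min_def max_def split: if_splits)
      then show ?thesis unfolding ** m v(1,3)[symmetric] using 3 by simp
    qed
  qed
  then show ?thesis
    using pos s0 c by (simp add: prime_multiplicity_le_imp_dvd \<sigma>_def[symmetric]) blast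
qed simp

section \<open>Two-by-two matrices and the normalizer condition\<close>

definition mat2 :: "'a \<Rightarrow> 'a \<Rightarrow> 'a \<Rightarrow> 'a \<Rightarrow> 'a::zero^2^2" where
  "mat2 a b c d = vector [vector [a, b], vector [c, d]]"

lemma mat2_nth [simp]:
  "mat2 a b c d $ 1 $ 1 = a" "mat2 a b c d $ 1 $ 2 = b"
  "mat2 a b c d $ 2 $ 1 = c" "mat2 a b c d $ 2 $ 2 = d"
  by (simp_all add: mat2_def)

lemma mat2_collapse: "A = mat2 (A $ 1 $ 1) (A $ 1 $ 2) (A $ 2 $ 1) (A $ 2 $ 2)"
  by (simp add: vec_eq_iff forall_2)

lemma mat2_eq_iff:
  "mat2 a b c d = mat2 a' b' c' d' \<longleftrightarrow> a = a' \<and> b = b' \<and> c = c' \<and> d = d'"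
  by (auto simp: vec_eq_iff forall_2)

lemma mat2_mult:
  "mat2 a b c d ** mat2 a' b' c' d' =
    (mat2 (a * a' + b * c') (a * b' + b * d') (c * a' + d * c') (c * b' + d * d') :: real^2^2)"
  by (simp add: vec_eq_iff forall_2 matrix_matrix_mult_def sum_2)

lemma det_mat2: "det (mat2 a b c d) = a * d - b * (c :: 'a :: comm_ring_1)"
  by (simp add: det_2)

lemma mat_1_eq_mat2: "(mat 1 :: real^2^2) = mat2 1 0 0 1"
  by (simp add: vec_eq_iff forall_2 mat_def)

lemma inv_SL2R:
  assumes "a * d - b * c = 1"
  shows "inv\<^bsub>SL2R\<^esub> (mat2 a b c d) = mat2 d (- b) (- c) a"
proof (rule group.inv_equality[OF group_SL2R])
  show "mat2 d (- b) (- c) a \<otimes>\<^bsub>SL2R\<^esub> mat2 a b c d = \<one>\<^bsub>SL2R\<^esub>"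
    using assms by (simp add: SL2R_def mat2_mult mat_1_eq_mat2 mat2_eq_iff algebra_simps)
qed (use assms in \<open>auto simp: SL2R_def det_mat2 algebra_simps\<close>)

lemma mem_Gamma01_iff:
  assumes "D dvd N"
  shows "mat2 a b c d \<in> Gamma01 N D \<longleftrightarrow>
    (\<exists>k l m n :: int. a = of_int k \<and> b = of_int l \<and> c = of_int (int N * m) \<and> d = of_int n \<and>
      k * n - l * (int N * m) = 1 \<and> int D dvd k - 1 \<and> int D dvd n - 1)" (is "?l \<longleftrightarrow> ?r")
proof
  assume ?l
  then obtain B :: "int^2^2" where B: "B \<in> Gamma0 N" "B \<in> Gamma1 D"
      "mat2 a b c d = map_matrix real_of_int B" by (auto simp: Gamma01_def)
  then obtain m where m: "B $ 2 $ 1 = int N * m" by (auto simp: Gamma0_def)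
  have "a = B $ 1 $ 1" "b = B $ 1 $ 2" "c = B $ 2 $ 1" "d = B $ 2 $ 2"
    using B(3) by (auto simp: vec_eq_iff forall_2 map_matrix_def)
  then show ?r using B(1,2) m
    by (intro exI[of _ "B $ 1 $ 1"] exI[of _ "B $ 1 $ 2"] exI[of _ m] exI[of _ "B $ 2 $ 2"])
      (auto simp: Gamma0_def Gamma1_def det_2)
next
  assume ?r
  then obtain k l m n :: int where *: "a = of_int k" "b = of_int l" "c = of_int (int N * m)"
    "d = of_int n" "k * n - l * (int N * m) = 1" "int D dvd k - 1" "int D dvd n - 1" by blast
  have "mat2 a b c d = map_matrix real_of_int (mat2 k l (int N * m) n)"
    using * by (simp add: vec_eq_iff forall_2 map_matrix_def)
  moreover have "mat2 k l (int N * m) n \<in> Gamma0 N \<inter> Gamma1 D"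
    using * assms by (auto simp: Gamma0_def Gamma1_def det_2)
  ultimately show ?l by (auto simp: Gamma01_def)
qed

text \<open>Conjugation by \<open>A\<close> and by its inverse are mutually inverse maps, so
  equality of a set with its conjugate is stability under both. This replaces an equation of sets by
  membership tests on single matrices.\<close>

lemma mem_normalizer_Gamma01_iff:
  "A \<in> normalizer SL2R (Gamma01 N D) \<longleftrightarrow> A \<in> carrier SL2R \<and>
    (\<forall>X \<in> Gamma01 N D. A ** X ** inv\<^bsub>SL2R\<^esub> A \<in> Gamma01 N D \<and>
      inv\<^bsub>SL2R\<^esub> A ** X ** A \<in> Gamma01 N D)"
proof (cases "A \<in> carrier SL2R")
  case True
  define B where "B = inv\<^bsub>SL2R\<^esub> A"
  have "A \<otimes>\<^bsub>SL2R\<^esub> B = \<one>\<^bsub>SL2R\<^esub>" "B \<otimes>\<^bsub>SL2R\<^esub> A = \<one>\<^bsub>SL2R\<^esub>"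
    using True group_SL2R by (simp_all add: B_def group.r_inv group.l_inv)
  then have AB: "A ** B = mat 1" "B ** A = mat 1" by (simp_all add: SL2R_def)
  have conj: "A <#\<^bsub>SL2R\<^esub> G #>\<^bsub>SL2R\<^esub> B = (\<lambda>X. A ** X ** B) ` G" for G
    by (auto simp: l_coset_def r_coset_def SL2R_def)
  have 1: "B ** (A ** X ** B) ** A = X" for X
  proof -
    have "B ** (A ** X ** B) ** A = (B ** A) ** X ** (B ** A)" by (simp only: matrix_mul_assoc)
    then show ?thesis by (simp add: AB)
  qed
  have 2: "A ** (B ** X ** A) ** B = X" for X
  proof -
    have "A ** (B ** X ** A) ** B = (A ** B) ** X ** (A ** B)" by (simp only: matrix_mul_assoc)
    then show ?thesis by (simp add: AB)
  qed
  have "(\<lambda>X. A ** X ** B) ` G = G \<longleftrightarrow> (\<forall>X\<in>G. A ** X ** B \<in> G \<and> B ** X ** A \<in> G)" for G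
  proof
    assume *: "(\<lambda>X. A ** X ** B) ` G = G"
    show "\<forall>X\<in>G. A ** X ** B \<in> G \<and> B ** X ** A \<in> G"
    proof
      fix X assume X: "X \<in> G"
      then have "X \<in> (\<lambda>X. A ** X ** B) ` G" by (simp only: *)
      then obtain Y where Y: "Y \<in> G" "X = A ** Y ** B" by blast
      have "B ** X ** A \<in> G" using Y(1) unfolding Y(2) 1 .
      moreover have "A ** X ** B \<in> G" using X by (subst *[symmetric]) (rule imageI)
      ultimately show "A ** X ** B \<in> G \<and> B ** X ** A \<in> G" by blast
    qed
  next
    assume *: "\<forall>X\<in>G. A ** X ** B \<in> G \<and> B ** X ** A \<in> G"
    show "(\<lambda>X. A ** X ** B) ` G = G"
    proof
      show "G \<subseteq> (\<lambda>X. A ** X ** B) ` G"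
      proof
        fix X assume "X \<in> G"
        then have "B ** X ** A \<in> G" using * by blast
        then show "X \<in> (\<lambda>X. A ** X ** B) ` G" by (rule rev_image_eqI) (simp only: 2)
      qed
    qed (use * in auto)
  qed
  then show ?thesis using True by (simp add: normalizer_Gamma01 conj flip: B_def)
qed (simp add: normalizer_Gamma01)

section \<open>Conjugation in the coordinates x, y, z, w\<close>

text \<open>The exact divisor \<open>\<mu>\<close> of a presentation does not occur: the square
  parts of \<open>\<mu>\<close> and \<open>N div \<mu>\<close> enter only through their product
  \<open>s\<close>, so the same integers serve for every admissible way of sharing the primes of
  \<open>s\<close> between the two. The diagonal coordinates \<open>x\<close>, \<open>y\<close> come
  before the off-diagonal ones.\<close>

definition star_mat :: "nat \<Rightarrow> nat \<Rightarrow> nat \<Rightarrow> int \<Rightarrow> int \<Rightarrow> int \<Rightarrow> int \<Rightarrow> real^2^2" where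
  "star_mat s g h x y z w = mat2 (of_int x * sqrt (real g)) (of_int z / (real s * sqrt (real g)))
     (of_int w * real s * real h * sqrt (real g)) (of_int y * sqrt (real g))"

lemma det_star_mat:
  assumes "s > 0" "g > 0"
  shows "det (star_mat s g h x y z w) = of_int (x * y * int g - z * w * int h)"
  using assms by (simp add: star_mat_def det_mat2 field_simps)

lemma inv_star_mat:
  assumes "s > 0" "g > 0" "x * y * int g - z * w * int h = 1"
  shows "inv\<^bsub>SL2R\<^esub> (star_mat s g h x y z w) = star_mat s g h y x (- z) (- w)"
proof -
  have "det (star_mat s g h x y z w) = 1" using assms by (simp add: det_star_mat)
  then show ?thesis unfolding star_mat_def by (subst inv_SL2R) (auto simp: det_mat2 mat2_eq_iff)
qed

text \<open>The determinant relation makes the diagonal entries integers. Membership can thus fail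
  off the diagonal only through the term with denominator \<open>s\<close> and the term lacking one
  factor \<open>s\<close> of \<open>N\<close>.\<close>

lemma star_mat_conj:
  fixes s g h N :: nat and x y z w k l m n :: int
  assumes "s > 0" "g > 0" "x * y * int g - z * w * int h = 1" "N = s\<^sup>2 * (g * h)"
  shows "star_mat s g h x y z w ** mat2 (of_int k) (of_int l) (of_int (int N * m)) (of_int n)
      ** star_mat s g h y x (- z) (- w) =
    mat2 (of_int (k + z * w * int h * (k - n) + int (s * (g * h)) * (z * y * m - x * w * l)))
         (of_int ((n - k) * (x * z)) / real s + of_int (x\<^sup>2 * int g * l - z\<^sup>2 * int h * m))
         (real s * real (g * h) * of_int ((k - n) * (w * y)) + real N * of_int (int g * y\<^sup>2 * m - int h * w\<^sup>2 * l))
         (of_int (n - z * w * int h * (k - n) - int (s * (g * h)) * (z * y * m - x * w * l)))"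
proof -
  define r where "r = sqrt (real g)"
  have r: "real g = r * r" "r \<noteq> 0" using assms by (auto simp: r_def)
  have N: "real N = real s * real s * (r * r * real h)"
    using assms(4) r by (simp add: power2_eq_square)
  have "real_of_int (x * y * int g - z * w * int h) = 1" using assms(3) by (simp only: of_int_1)
  then have d: "real_of_int x * real_of_int y * (r * r) = 1 + real_of_int z * real_of_int w * real h"
    by (simp add: r)
  have s: "real s \<noteq> 0" using assms by simp
  \<comment> \<open>The entries are treated as identities over arbitrary reals. In the diagonal ones
    the product \<open>X * Y * (r * r)\<close> is isolated first so that the determinant relation
    can rewrite it.\<close>
  have 1: "(X * r * K + Z / (S * r) * (S * S * (r * r * H) * M)) * (Y * r)
      + (X * r * L + Z / (S * r) * Q) * (- W * S * H * r)
      = K + Z * W * H * (K - Q) + S * (r * r * H) * (Z * Y * M - X * W * L)"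
    if "X * Y * (r * r) = 1 + Z * W * H" "S \<noteq> 0" for X Y Z W H S K L M Q :: real
  proof -
    have "(X * r * K + Z / (S * r) * (S * S * (r * r * H) * M)) * (Y * r)
      + (X * r * L + Z / (S * r) * Q) * (- W * S * H * r)
      = (X * Y * (r * r)) * K + Z * S * H * M * Y * r * r - X * L * W * S * H * r * r - Z * Q * W * H"
      using r(2) that(2) by (simp add: field_simps)
    then show ?thesis unfolding that(1) by (simp add: algebra_simps)
  qed
  have 4: "(W * S * H * r * K + Y * r * (S * S * (r * r * H) * M)) * (- Z / (S * r))
      + (W * S * H * r * L + Y * r * Q) * (X * r)
      = Q - Z * W * H * (K - Q) - S * (r * r * H) * (Z * Y * M - X * W * L)"
    if "X * Y * (r * r) = 1 + Z * W * H" "S \<noteq> 0" for X Y Z W H S K L M Q :: real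
  proof -
    have "(W * S * H * r * K + Y * r * (S * S * (r * r * H) * M)) * (- Z / (S * r))
      + (W * S * H * r * L + Y * r * Q) * (X * r)
      = (X * Y * (r * r)) * Q - W * H * K * Z - Y * S * r * r * H * M * Z + W * S * H * r * r * L * X"
      using r(2) that(2) by (simp add: field_simps)
    then show ?thesis unfolding that(1) by (simp add: algebra_simps)
  qed
  have 2: "(X * r * K + Z / (S * r) * (S * S * (r * r * H) * M)) * (- Z / (S * r))
      + (X * r * L + Z / (S * r) * Q) * (X * r)
      = (Q - K) * (X * Z) / S + (X * X * (r * r) * L - Z * Z * H * M)"
    if "S \<noteq> 0" for X Z H S K L M Q :: real
    using r(2) that by (simp add: field_simps)
  have 3: "(W * S * H * r * K + Y * r * (S * S * (r * r * H) * M)) * (Y * r)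
      + (W * S * H * r * L + Y * r * Q) * (- W * S * H * r)
      = S * (r * r * H) * ((K - Q) * (W * Y)) + S * S * (r * r * H) * (r * r * (Y * Y) * M - H * (W * W) * L)"
    for Y W H S K L M Q :: real
    by (simp add: algebra_simps)
  show ?thesis
    unfolding star_mat_def mat2_mult mat2_eq_iff r_def[symmetric]
    using 1[OF d s] 2[OF s] 3 4[OF d s]
    by (simp add: N r(1) power2_eq_square)
qed

lemma int_dvd_star_sigma_mult_iff:
  fixes N D s t :: nat and c :: int
  assumes "N > 0" "D dvd N" "s = square_part N" "N = s\<^sup>2 * t"
  shows "int s dvd int (star_sigma N D) * c \<longleftrightarrow>
    int s dvd int (lcm 24 (2 * D)) * c \<and> int D dvd int (s * t) * c"
proof -
  have nn: "int a dvd int b * c \<longleftrightarrow> a dvd b * nat \<bar>c\<bar>" for a b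
  proof -
    have "int a dvd int b * c \<longleftrightarrow> int a dvd \<bar>int b * c\<bar>" by simp
    also have "\<bar>int b * c\<bar> = int (b * nat \<bar>c\<bar>)" by (simp add: abs_mult)
    finally show ?thesis by (simp only: int_dvd_int_iff)
  qed
  show ?thesis unfolding nn by (rule dvd_star_sigma_mult_iff[OF assms])
qed

lemma coprime_dvd_mult_cancel:
  fixes a b c d :: int
  assumes "coprime a b" "d dvd c * a" "d dvd c * b"
  shows "d dvd c"
proof -
  have "d dvd gcd (c * a) (c * b)" using assms(2,3) by simp
  then show ?thesis using assms(1) by (simp add: gcd_mult_left coprime_iff_gcd_eq_1)
qed

text \<open>The conditions come from the upper right entry, the lower left entry and the diagonal,
  in this order. Because \<open>D\<close> divides \<open>k - n\<close>, both diagonal entries impose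
  the same congruence.\<close>

lemma star_mat_conj_mem_Gamma01_iff:
  fixes s g h N D :: nat and x y z w k l m n :: int
  assumes "s > 0" "g > 0" "h > 0" "x * y * int g - z * w * int h = 1" "N = s\<^sup>2 * (g * h)" "D dvd N"
    and X: "k * n - l * (int N * m) = 1" "int D dvd k - 1" "int D dvd n - 1"
  shows "star_mat s g h x y z w ** mat2 (of_int k) (of_int l) (of_int (int N * m)) (of_int n)
      ** star_mat s g h y x (- z) (- w) \<in> Gamma01 N D \<longleftrightarrow>
    int s dvd (n - k) * (x * z) \<and> int s dvd (k - n) * (w * y) \<and>
    int D dvd int (s * (g * h)) * (z * y * m - x * w * l)" (is "?C \<in> _ \<longleftrightarrow> ?r")
proof -
  define a where "a = k + z * w * int h * (k - n) + int (s * (g * h)) * (z * y * m - x * w * l)"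
  define b where "b = x\<^sup>2 * int g * l - z\<^sup>2 * int h * m"
  define c where "c = int g * y\<^sup>2 * m - int h * w\<^sup>2 * l"
  define d where "d = n - z * w * int h * (k - n) - int (s * (g * h)) * (z * y * m - x * w * l)"
  have C: "?C = mat2 (of_int a) (of_int ((n - k) * (x * z)) / real s + of_int b)
      (real s * real (g * h) * of_int ((k - n) * (w * y)) + real N * of_int c) (of_int d)"
    unfolding a_def b_def c_def d_def by (rule star_mat_conj) fact+
  have s: "real s \<noteq> 0" and gh: "real (g * h) \<noteq> 0" using assms by simp_all
  have N: "real N = real s * (real (g * h) * real s)" using assms(5) by (simp add: power2_eq_square)
  have Dkn: "int D dvd k - n" using dvd_diff[OF X(2,3)] by simp
  have Da: "int D dvd a - 1 \<longleftrightarrow> int D dvd int (s * (g * h)) * (z * y * m - x * w * l)"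
  proof -
    have "int D dvd (k - 1) + z * w * int h * (k - n)" using X(2) Dkn by simp
    moreover have "a - 1 = ((k - 1) + z * w * int h * (k - n)) + int (s * (g * h)) * (z * y * m - x * w * l)"
      by (simp add: a_def)
    ultimately show ?thesis by (metis dvd_add_right_iff)
  qed
  have Dd: "int D dvd d - 1 \<longleftrightarrow> int D dvd int (s * (g * h)) * (z * y * m - x * w * l)"
  proof -
    have "int D dvd (n - 1) - z * w * int h * (k - n)" using X(3) Dkn by simp
    moreover have "d - 1 = ((n - 1) - z * w * int h * (k - n)) - int (s * (g * h)) * (z * y * m - x * w * l)"
      by (simp add: d_def)
    ultimately show ?thesis by (metis dvd_diff_right_iff)
  qed
  show ?thesis
  proof
    assume "?C \<in> Gamma01 N D"
    then obtain a' b' c' :: int where *: "real_of_int a = of_int a'"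
      "of_int ((n - k) * (x * z)) / real s + of_int b = of_int b'"
      "real s * real (g * h) * of_int ((k - n) * (w * y)) + real N * of_int c = of_int (int N * c')"
      "int D dvd a' - 1"
      unfolding C mem_Gamma01_iff[OF assms(6)] by blast
    have "of_int ((n - k) * (x * z)) = (of_int (int s * (b' - b)) :: real)"
      using *(2) s by (simp add: field_simps)
    then have "(n - k) * (x * z) = int s * (b' - b)" by (simp only: of_int_eq_iff)
    moreover have "(real s * real (g * h)) * of_int ((k - n) * (w * y))
        = (real s * real (g * h)) * of_int (int s * (c' - c))"
      using *(3) by (simp add: N algebra_simps)
    then have "of_int ((k - n) * (w * y)) = (of_int (int s * (c' - c)) :: real)"
      using s gh by (metis mult_cancel_left mult_eq_0_iff)
    then have "(k - n) * (w * y) = int s * (c' - c)" by (simp only: of_int_eq_iff)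
    moreover have "a = a'" using *(1) by simp
    ultimately show ?r using *(4) Da by simp
  next
    assume r: ?r
    then obtain e f where ef: "(n - k) * (x * z) = int s * e" "(k - n) * (w * y) = int s * f" by blast
    have C': "?C = mat2 (of_int a) (of_int (e + b)) (of_int (int N * (f + c))) (of_int d)"
      unfolding C ef using s by (simp add: N mat2_eq_iff algebra_simps)
    have "det ?C = 1"
    proof -
      have "det (star_mat s g h x y z w) = 1" "det (star_mat s g h y x (- z) (- w)) = 1"
        using assms by (simp_all add: det_star_mat mult.commute)
      moreover have "real_of_int (k * n - l * (int N * m)) = 1" by (simp only: X(1) of_int_1)
      ultimately show ?thesis by (simp add: det_mul det_mat2)
    qed
    then have "real_of_int (a * d - (e + b) * (int N * (f + c))) = of_int 1"
      unfolding C' by (simp add: det_mat2)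
    then have "a * d - (e + b) * (int N * (f + c)) = 1" by (simp only: of_int_eq_iff)
    then show "?C \<in> Gamma01 N D"
      unfolding C' mem_Gamma01_iff[OF assms(6)] using r Da Dd by blast
  qed
qed

text \<open>The inverse has the same shape with \<open>x\<close>, \<open>y\<close> exchanged and
  \<open>z\<close>, \<open>w\<close> negated. Conjugating both ways therefore yields the same kind
  of condition for \<open>xz\<close>, \<open>wy\<close> and for \<open>yz\<close>,
  \<open>wx\<close>.\<close>

lemma star_mat_mem_normalizer_iff:
  fixes s g h N D :: nat and x y z w :: int
  assumes "N > 0" "D dvd N" "s = square_part N" "N = s\<^sup>2 * (g * h)"
    and det: "x * y * int g - z * w * int h = 1"
  shows "star_mat s g h x y z w \<in> normalizer SL2R (Gamma01 N D) \<longleftrightarrow>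
    int s dvd int (star_sigma N D) * (x * z) \<and> int s dvd int (star_sigma N D) * (w * y)"
proof -
  let ?A = "star_mat s g h x y z w" and ?B = "star_mat s g h y x (- z) (- w)"
  have pos: "s > 0" "g > 0" "h > 0" using assms(1,4) by (auto intro!: gr0I)
  have det': "y * x * int g - - z * - w * int h = 1" using det by (simp add: mult.commute)
  have inv: "inv\<^bsub>SL2R\<^esub> ?A = ?B" by (rule inv_star_mat) fact+
  have carr: "?A \<in> carrier SL2R" using pos det by (simp add: SL2R_def det_star_mat)
  define V where "V k l m n \<longleftrightarrow> k * n - l * (int N * m) = 1 \<and> int D dvd k - 1 \<and> int D dvd n - 1"
    for k l m n
  define P where "P c \<longleftrightarrow> (\<forall>k n. int N dvd k * n - 1 \<longrightarrow> int D dvd k - 1 \<longrightarrow> int D dvd n - 1 \<longrightarrow>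
    int s dvd (k - n) * c) \<and> int D dvd int (s * (g * h)) * c" for c
  have P_iff: "P c \<longleftrightarrow> int s dvd int (star_sigma N D) * c" for c
    unfolding P_def int_dvd_star_sigma_mult_iff[OF assms(1-4)]
    using dvd_unit_minus_inverse_iff[OF assms(1,2), of s c] assms(4) by (simp add: power2_eq_square)
  have ball: "(\<forall>X\<in>Gamma01 N D. Q X) \<longleftrightarrow>
      (\<forall>k l m n. V k l m n \<longrightarrow> Q (mat2 (of_int k) (of_int l) (of_int (int N * m)) (of_int n)))" for Q
  proof
    assume *: "\<forall>k l m n. V k l m n \<longrightarrow> Q (mat2 (of_int k) (of_int l) (of_int (int N * m)) (of_int n))"
    show "\<forall>X\<in>Gamma01 N D. Q X"
    proof
      fix X assume "X \<in> Gamma01 N D"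
      then have "mat2 (X $ 1 $ 1) (X $ 1 $ 2) (X $ 2 $ 1) (X $ 2 $ 2) \<in> Gamma01 N D"
        by (simp flip: mat2_collapse)
      then show "Q X" using * unfolding mem_Gamma01_iff[OF assms(2)] V_def
        by (metis mat2_collapse)
    qed
  next
    assume *: "\<forall>X\<in>Gamma01 N D. Q X"
    show "\<forall>k l m n. V k l m n \<longrightarrow> Q (mat2 (of_int k) (of_int l) (of_int (int N * m)) (of_int n))"
    proof (intro allI impI)
      fix k l m n assume "V k l m n"
      then have "mat2 (of_int k) (of_int l) (of_int (int N * m)) (of_int n) \<in> Gamma01 N D"
        unfolding mem_Gamma01_iff[OF assms(2)] V_def by blast
      with * show "Q (mat2 (of_int k) (of_int l) (of_int (int N * m)) (of_int n))" by blast
    qed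
  qed
  have "?A \<in> normalizer SL2R (Gamma01 N D) \<longleftrightarrow> (\<forall>k l m n. V k l m n \<longrightarrow>
      (int s dvd (n - k) * (x * z) \<and> int s dvd (k - n) * (w * y) \<and>
        int D dvd int (s * (g * h)) * (z * y * m - x * w * l)) \<and>
      (int s dvd (n - k) * (y * - z) \<and> int s dvd (k - n) * (- w * x) \<and>
        int D dvd int (s * (g * h)) * (- z * x * m - y * - w * l)))"
    unfolding mem_normalizer_Gamma01_iff inv ball
    using star_mat_conj_mem_Gamma01_iff[OF pos det assms(4,2)]
      star_mat_conj_mem_Gamma01_iff[OF pos det' assms(4,2)] carr
    by (simp add: V_def)
  also have "\<dots> \<longleftrightarrow> P (x * z) \<and> P (w * y) \<and> P (y * z) \<and> P (w * x)" (is "?l \<longleftrightarrow> ?r")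
  proof
    assume l: ?l
    have "int s dvd (k - n) * (x * z) \<and> int s dvd (k - n) * (w * y) \<and>
        int s dvd (k - n) * (y * z) \<and> int s dvd (k - n) * (w * x)"
      if kn: "int N dvd k * n - 1" "int D dvd k - 1" "int D dvd n - 1" for k n
    proof -
      obtain m where "k * n - 1 = int N * m" using kn(1) by blast
      then have V: "V k 1 m n" using kn by (simp add: V_def)
      have sw: "int s dvd (k - n) * c \<longleftrightarrow> int s dvd (n - k) * c" for c
        by (metis dvd_minus_iff minus_diff_eq mult_minus_left)
      show ?thesis using l[rule_format, OF V] unfolding sw[of "x * z"] sw[of "y * z"] by simp
    qed
    \<comment> \<open>With k = n = 1 only the congruence modulo \<open>D\<close> survives; these two
      elements separate its terms in \<open>l\<close> and in \<open>m\<close>.\<close>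
    moreover have "V 1 1 0 1" "V 1 0 1 1" by (simp_all add: V_def)
    note l[rule_format, OF this(1)] l[rule_format, OF this(2)]
    ultimately show ?r unfolding P_def by (simp add: mult_ac)
  next
    assume r: ?r
    show ?l
    proof (intro allI impI)
      fix k l m n assume V: "V k l m n"
      then have "k * n - 1 = int N * (l * m)" by (simp add: V_def algebra_simps)
      then have kn: "int N dvd k * n - 1" "int D dvd k - 1" "int D dvd n - 1"
        using V by (simp_all add: V_def)
      have sw: "int s dvd (n - k) * c" if "int s dvd (k - n) * c" for c
        using that by (metis dvd_minus_iff minus_diff_eq mult_minus_left)
      have P1: "int s dvd (k - n) * c" if "P c" for c using that kn unfolding P_def by blast
      have P2: "int D dvd int (s * (g * h)) * (c * m - d * l)" if "P c" "P d" for c d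
      proof -
        have "int D dvd int (s * (g * h)) * c * m - int (s * (g * h)) * d * l"
          using that unfolding P_def by (intro dvd_diff) (auto intro: dvd_mult2)
        then show ?thesis by (simp add: algebra_simps)
      qed
      have "int D dvd int (s * (g * h)) * (z * y * m - x * w * l)"
        using P2[of "y * z" "w * x"] r by (simp add: mult.commute)
      moreover have "int D dvd int (s * (g * h)) * (- z * x * m - y * - w * l)"
      proof -
        have "- (int (s * (g * h)) * (x * z * m - w * y * l))
            = int (s * (g * h)) * (- z * x * m - y * - w * l)" by (simp add: algebra_simps)
        moreover have "int D dvd - (int (s * (g * h)) * (x * z * m - w * y * l))"
          using P2[of "x * z" "w * y"] r by simp
        ultimately show ?thesis by (simp only:)
      qed
      moreover have "int s dvd (n - k) * (y * - z)" "int s dvd (k - n) * (- w * x)"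
        using sw[OF P1, of "y * z"] P1[of "w * x"] r by simp_all
      ultimately show "(int s dvd (n - k) * (x * z) \<and> int s dvd (k - n) * (w * y) \<and>
        int D dvd int (s * (g * h)) * (z * y * m - x * w * l)) \<and>
      (int s dvd (n - k) * (y * - z) \<and> int s dvd (k - n) * (- w * x) \<and>
        int D dvd int (s * (g * h)) * (- z * x * m - y * - w * l))"
        using sw[OF P1] P1 r by blast
    qed
  qed
  also have "\<dots> \<longleftrightarrow> P (x * z) \<and> P (w * y)"
  proof -
    \<comment> \<open>The determinant makes \<open>x\<close>, \<open>y\<close> prime to
      \<open>z\<close>, \<open>w\<close>. Multiples of \<open>xz\<close> and \<open>wy\<close> give
      \<open>yz\<close> times \<open>x\<close> and times \<open>w\<close>, hence \<open>yz\<close>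
      itself; likewise for \<open>wx\<close>.\<close>
    have cop: "coprime (x * y * int g) (z * w * int h)"
    proof (rule coprimeI)
      fix c assume "c dvd x * y * int g" "c dvd z * w * int h"
      then have "c dvd x * y * int g - z * w * int h" by (rule dvd_diff)
      then show "is_unit c" by (simp only: det)
    qed
    have "P (y * z) \<and> P (w * x)" if "P (x * z)" "P (w * y)"
    proof -
      have *: "int s dvd int (star_sigma N D) * (x * z) * c"
          "int s dvd int (star_sigma N D) * (w * y) * c" for c
        using that unfolding P_iff by (auto intro: dvd_mult2)
      have "int s dvd int (star_sigma N D) * (y * z)"
        by (rule coprime_dvd_mult_cancel[of x w]) (use cop *[of y] *[of z] in \<open>auto simp: ac_simps\<close>)
      moreover have "int s dvd int (star_sigma N D) * (w * x)"
        by (rule coprime_dvd_mult_cancel[of y z]) (use cop *[of w] *[of x] in \<open>auto simp: ac_simps\<close>)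
      ultimately show ?thesis unfolding P_iff by blast
    qed
    then show ?thesis by blast
  qed
  finally show ?thesis unfolding P_iff .
qed

section \<open>The shape of normalizing matrices\<close>

text \<open>With T = (1,1;0,1) and L = (1,0;N,1), A T A^-1 yields \<alpha>^2, \<gamma>^2 and
  \<alpha>\<gamma>, A^-1 T A yields \<delta>^2, and A L A^-1 yields N\<beta>^2 and N\<beta>\<delta>.
  The two mixed products later tie the square classes of different entries together.\<close>

lemma normalizer_imp_integral:
  fixes N D :: nat and \<alpha> \<beta> \<gamma> \<delta> :: real
  assumes "D dvd N" "\<alpha> * \<delta> - \<beta> * \<gamma> = 1"
    and A: "mat2 \<alpha> \<beta> \<gamma> \<delta> \<in> normalizer SL2R (Gamma01 N D)"
  shows "\<alpha>\<^sup>2 \<in> \<int>" "\<delta>\<^sup>2 \<in> \<int>" "real N * \<beta>\<^sup>2 \<in> \<int>" "\<exists>S::int. \<gamma>\<^sup>2 = real N * of_int S"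
    "\<alpha> * \<gamma> \<in> \<int>" "real N * (\<beta> * \<delta>) \<in> \<int>"
proof -
  have T: "mat2 1 1 0 1 \<in> Gamma01 N D" unfolding mem_Gamma01_iff[OF assms(1)]
    by (intro exI[of _ 1] exI[of _ 0]) simp
  have L: "mat2 1 0 (real N) 1 \<in> Gamma01 N D" unfolding mem_Gamma01_iff[OF assms(1)]
    by (intro exI[of _ 1] exI[of _ 0]) simp
  have *: "mat2 \<alpha> \<beta> \<gamma> \<delta> ** X ** mat2 \<delta> (- \<beta>) (- \<gamma>) \<alpha> \<in> Gamma01 N D"
    "mat2 \<delta> (- \<beta>) (- \<gamma>) \<alpha> ** X ** mat2 \<alpha> \<beta> \<gamma> \<delta> \<in> Gamma01 N D" if "X \<in> Gamma01 N D" for X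
    using A that unfolding mem_normalizer_Gamma01_iff inv_SL2R[OF assms(2)] by blast+
  have 1: "mat2 (\<alpha> * \<delta> - \<beta> * \<gamma> - \<alpha> * \<gamma>) (\<alpha>\<^sup>2) (- \<gamma>\<^sup>2) (\<alpha> * \<delta> - \<beta> * \<gamma> + \<alpha> * \<gamma>) \<in> Gamma01 N D"
    using *(1)[OF T] unfolding mat2_mult by (simp add: algebra_simps power2_eq_square)
  have 2: "mat2 (\<alpha> * \<delta> - \<beta> * \<gamma> + \<gamma> * \<delta>) (\<delta>\<^sup>2) (- \<gamma>\<^sup>2) (\<alpha> * \<delta> - \<beta> * \<gamma> - \<gamma> * \<delta>) \<in> Gamma01 N D"
    using *(2)[OF T] unfolding mat2_mult by (simp add: algebra_simps power2_eq_square)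
  have 3: "mat2 (\<alpha> * \<delta> - \<beta> * \<gamma> + real N * (\<beta> * \<delta>)) (- (real N * \<beta>\<^sup>2)) (real N * \<delta>\<^sup>2)
      (\<alpha> * \<delta> - \<beta> * \<gamma> - real N * (\<beta> * \<delta>)) \<in> Gamma01 N D"
    using *(1)[OF L] unfolding mat2_mult by (simp add: algebra_simps power2_eq_square)
  show "\<alpha>\<^sup>2 \<in> \<int>" using 1 unfolding mem_Gamma01_iff[OF assms(1)] by auto
  show "\<delta>\<^sup>2 \<in> \<int>" using 2 unfolding mem_Gamma01_iff[OF assms(1)] by auto
  have "- (real N * \<beta>\<^sup>2) \<in> \<int>" using 3 unfolding mem_Gamma01_iff[OF assms(1)] by force
  then show "real N * \<beta>\<^sup>2 \<in> \<int>" by (simp only: minus_in_Ints_iff)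
  obtain m :: int where "- \<gamma>\<^sup>2 = of_int (int N * m)"
    using 1 unfolding mem_Gamma01_iff[OF assms(1)] by blast
  then have "\<gamma>\<^sup>2 = real N * of_int (- m)" by simp
  then show "\<exists>S::int. \<gamma>\<^sup>2 = real N * of_int S" ..
  have "1 - \<alpha> * \<gamma> \<in> \<int>" using 1 unfolding mem_Gamma01_iff[OF assms(1)] assms(2) by force
  then have "1 - (1 - \<alpha> * \<gamma>) \<in> \<int>" by (intro Ints_diff) auto
  then show "\<alpha> * \<gamma> \<in> \<int>" by simp
  have "1 + real N * (\<beta> * \<delta>) \<in> \<int>" using 3 unfolding mem_Gamma01_iff[OF assms(1)] assms(2) by force
  then have "(1 + real N * (\<beta> * \<delta>)) - 1 \<in> \<int>" by (intro Ints_diff) auto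
  then show "real N * (\<beta> * \<delta>) \<in> \<int>" by simp
qed

lemma nonneg_Ints_natE:
  assumes "a \<in> \<int>" "a \<ge> (0::real)"
  obtains n :: nat where "a = real n"
  using assms by (metis Ints_cases of_nat_nat of_int_0_le_iff of_int_of_nat_eq)

lemma square_eq_signed:
  fixes a r :: real and n :: nat
  assumes "a\<^sup>2 = (real n * r)\<^sup>2"
  obtains k :: int where "a = of_int k * r" "k\<^sup>2 = (int n)\<^sup>2"
proof -
  have "a = of_int (int n) * r \<or> a = of_int (- int n) * r" using assms by (auto simp: power2_eq_iff)
  then show ?thesis using that[of "int n"] that[of "- int n"] by auto
qed

text \<open>The integers \<open>P * S * t\<close> and \<open>Q * R * t\<close> are squares because
  \<alpha>\<gamma> and N\<beta>\<delta> are integers, so each pair gives a splitting of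
  \<open>t\<close>. Coprimality of \<open>P\<close> with \<open>R\<close> and of \<open>Q\<close>
  with \<open>S\<close> makes the two splittings equal.\<close>

lemma normalizer_imp_star_mat:
  fixes N D s t :: nat
  assumes "N > 0" "D dvd N" "N = s\<^sup>2 * t" "squarefree t"
    and A: "A \<in> normalizer SL2R (Gamma01 N D)"
  obtains g h x y z w where "g * h = t" "x * y * int g - z * w * int h = 1"
    "A = star_mat s g h x y z w"
proof -
  define \<alpha> \<beta> \<gamma> \<delta> where "\<alpha> = A $ 1 $ 1" "\<beta> = A $ 1 $ 2" "\<gamma> = A $ 2 $ 1" "\<delta> = A $ 2 $ 2"
  have Aeq: "A = mat2 \<alpha> \<beta> \<gamma> \<delta>" unfolding \<alpha>_\<beta>_\<gamma>_\<delta>_def by (rule mat2_collapse)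
  have "A \<in> carrier SL2R" using A by (simp add: mem_normalizer_Gamma01_iff)
  then have det: "\<alpha> * \<delta> - \<beta> * \<gamma> = 1" by (simp add: SL2R_def Aeq det_mat2)
  note int = normalizer_imp_integral[OF assms(2) det A[unfolded Aeq]]
  have s: "s > 0" and t: "t > 0" using assms(1,3) by (auto intro!: gr0I)
  have N0: "real N > 0" using assms(1) by simp
  obtain P where P: "\<alpha>\<^sup>2 = real P" using int(1) by (rule nonneg_Ints_natE) simp
  obtain Q where Q: "\<delta>\<^sup>2 = real Q" using int(2) by (rule nonneg_Ints_natE) simp
  obtain R where R: "real N * \<beta>\<^sup>2 = real R" using int(3) by (rule nonneg_Ints_natE) simp
  obtain S where S: "\<gamma>\<^sup>2 = real N * real S"
  proof -
    obtain S' :: int where S': "\<gamma>\<^sup>2 = real N * of_int S'" using int(4) by blast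
    then have "real N * of_int S' \<ge> 0" by (metis zero_le_power2)
    then have "S' \<ge> 0" using N0 by (simp add: zero_le_mult_iff)
    then show ?thesis using that[of "nat S'"] S' by simp
  qed
  have PQ: "real (P * Q) = (\<alpha> * \<delta>)\<^sup>2" by (simp add: power_mult_distrib P Q)
  have RS: "real (R * S) = (\<beta> * \<gamma>)\<^sup>2"
    using R S N0 by (simp add: power_mult_distrib flip: R)
  have "coprime (P * Q) (R * S)"
  proof -
    \<comment> \<open>By the determinant \<open>e\<close> is 2\<beta>\<gamma>. As its square is
      \<open>4 * R * S\<close>, it is even, so \<beta>\<gamma> is an integer \<open>v\<close>, and
      \<open>P * Q\<close>, \<open>R * S\<close> are the squares of \<open>1 + v\<close> and
      \<open>v\<close>.\<close>
    define e where "e = int (P * Q) - int (R * S) - 1"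
    have eq: "\<alpha> * \<delta> = 1 + \<beta> * \<gamma>" using det by simp
    have "real_of_int e = real (P * Q) - real (R * S) - 1" by (simp add: e_def)
    also have "\<dots> = 2 * (\<beta> * \<gamma>)" unfolding PQ RS eq by (simp add: power2_eq_square algebra_simps)
    finally have e: "real_of_int e = 2 * (\<beta> * \<gamma>)" .
    then have "real_of_int (e\<^sup>2) = 4 * (\<beta> * \<gamma>)\<^sup>2" by (simp add: power_mult_distrib)
    also have "\<dots> = real_of_int (4 * int (R * S))" by (simp flip: RS)
    finally have e2: "e\<^sup>2 = 4 * int (R * S)" by (simp only: of_int_eq_iff)
    then have "even (e\<^sup>2)" by simp
    then obtain v where v: "e = 2 * v" by auto
    then have RS': "int (R * S) = v\<^sup>2" using e2 by (simp add: power_mult_distrib)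
    have PQ': "int (P * Q) = (1 + v)\<^sup>2"
    proof -
      have "int (P * Q) = e + int (R * S) + 1" by (simp add: e_def)
      then show ?thesis unfolding RS' v by (simp add: power2_eq_square algebra_simps)
    qed
    have "coprime (1 + v) v" by (rule coprimeI) (metis dvd_add_left_iff)
    then have "coprime (int (P * Q)) (int (R * S))" unfolding PQ' RS' by simp
    then show ?thesis by (simp only: coprime_int_iff)
  qed
  then have cop: "coprime P S" "coprime Q R" "coprime P R" "coprime Q S" by auto
  have square: "\<exists>r. a * b * t = r\<^sup>2" if "q \<in> \<int>" "q\<^sup>2 = real N * real a * real b" for a b and q :: real
  proof -
    have "\<bar>q\<bar> \<in> \<int>" using that(1) by simp
    then obtain n where n: "\<bar>q\<bar> = real n" by (rule nonneg_Ints_natE) simp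
    have "real (n\<^sup>2) = real (N * a * b)" using that(2) n by (metis of_nat_mult of_nat_power power2_abs)
    then have n2: "n\<^sup>2 = s\<^sup>2 * (a * b * t)" unfolding assms(3) of_nat_eq_iff by (simp add: ac_simps)
    then have "s dvd n" by (metis dvd_triv_left pow_divides_pow_iff zero_less_numeral)
    then obtain r where "n = s * r" by blast
    then have "a * b * t = r\<^sup>2" using n2 s by (simp add: power_mult_distrib)
    then show ?thesis ..
  qed
  obtain r1 where "P * S * t = r1\<^sup>2"
    using square[OF int(5), of P S] P S by (auto simp: power_mult_distrib ac_simps)
  then obtain g h x w where gh: "g * h = t" "P = g * x\<^sup>2" "S = h * w\<^sup>2"
    using coprime_mult_squarefree_eq_square[OF cop(1) _ assms(4)] by metis
  have "(real N * (\<beta> * \<delta>))\<^sup>2 = real N * real Q * (real N * \<beta>\<^sup>2)"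
    by (simp add: power_mult_distrib Q power2_eq_square[of "real N"])
  then have "(real N * (\<beta> * \<delta>))\<^sup>2 = real N * real Q * real R" by (simp only: R)
  then obtain r2 where "Q * R * t = r2\<^sup>2" using square[OF int(6), of Q R] by blast
  then obtain g' h' y z where gh': "g' * h' = t" "Q = g' * y\<^sup>2" "R = h' * z\<^sup>2"
    using coprime_mult_squarefree_eq_square[OF cop(2) _ assms(4)] by metis
  have "coprime g h'" "coprime g' h" using cop(3,4) gh gh' by auto
  moreover have "g dvd g' * h'" "g' dvd g * h" by (metis gh(1) gh'(1) dvd_triv_left)+
  ultimately have "g dvd g'" "g' dvd g" by (simp_all add: coprime_dvd_mult_left_iff)
  then have g': "g' = g" by (simp add: dvd_antisym)
  then have h': "h' = h" using gh(1) gh'(1) t by auto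
  have g: "g > 0" and h: "h > 0" using gh(1) t by (auto intro!: gr0I)
  have N: "real N = real s ^ 2 * (real g * real h)" using assms(3) by (simp flip: gh(1))
  have "\<alpha>\<^sup>2 = (real x * sqrt (real g))\<^sup>2" by (simp add: P gh(2) power_mult_distrib)
  then obtain x' :: int where x': "\<alpha> = of_int x' * sqrt (real g)" by (rule square_eq_signed)
  have "\<delta>\<^sup>2 = (real y * sqrt (real g))\<^sup>2" by (simp add: Q gh'(2) g' power_mult_distrib)
  then obtain y' :: int where y': "\<delta> = of_int y' * sqrt (real g)" by (rule square_eq_signed)
  have "\<gamma>\<^sup>2 = (real w * (real s * real h * sqrt (real g)))\<^sup>2"
    unfolding S gh(3) N by (simp add: power_mult_distrib power2_eq_square[of "real h"])
  then obtain w' :: int where w': "\<gamma> = of_int w' * (real s * real h * sqrt (real g))"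
    by (rule square_eq_signed)
  have "real s ^ 2 * (real g * real h) * \<beta>\<^sup>2 = real h * (real z)\<^sup>2"
    using R unfolding N gh'(3) h' by simp
  then have "\<beta>\<^sup>2 = (real z * (1 / (real s * sqrt (real g))))\<^sup>2"
    using s g h by (simp add: power_mult_distrib power_divide field_simps)
  then obtain z' :: int where z': "\<beta> = of_int z' * (1 / (real s * sqrt (real g)))"
    by (rule square_eq_signed)
  have Astar: "A = star_mat s g h x' y' z' w'"
    unfolding Aeq star_mat_def x' y' z' w' by (simp add: mat2_eq_iff)
  have "det A = 1" using det by (simp add: Aeq det_mat2)
  then have "real_of_int (x' * y' * int g - z' * w' * int h) = of_int 1"
    unfolding Astar det_star_mat[OF s g] by simp
  then have "x' * y' * int g - z' * w' * int h = 1" by (simp only: of_int_eq_iff)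
  then show ?thesis using that gh(1) Astar by blast
qed

section \<open>Presentations in the coordinates x, y, z, w\<close>

lemma denom_coprime:
  assumes "q > 0" "coprime p q"
  shows "denom (of_int p / of_int q) = q"
  using assms by (simp add: denom_def Fract_of_int_quotient[symmetric] quotient_of_Fract normalize_stable)

text \<open>The fractions need not be reduced. Reducing each replaces numerators and denominators by
  divisors, which keeps the cross coprimality, so the product of the reduced fractions is already in
  lowest terms.\<close>

lemma no_cancelation_of_coprime:
  fixes x z :: int and i j :: nat
  assumes "i > 0" "j > 0" "coprime z (int i)" "coprime x (int j)"
  shows "no_cancelation (of_int x / of_nat i) (of_int z / of_nat j)"
proof -
  have ex: "\<exists>x' i'. (of_int x / of_nat i :: rat) = of_int x' / of_int i' \<and> coprime x' i' \<and> i' > 0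
      \<and> x' dvd x \<and> i' dvd int i" if i: "i > 0" for x and i :: nat
  proof -
    have g: "gcd x (int i) > 0" using i by simp
    obtain x' i' where *: "x = x' * gcd x (int i)" "int i = i' * gcd x (int i)" "coprime x' i'"
      using gcd_coprime_exists[of x "int i"] g by auto
    have i': "i' > 0" using *(2) i g by (metis of_nat_0_less_iff zero_less_mult_pos2)
    have "(of_nat i :: rat) = of_int (int i)" by simp
    then have "(of_int x / of_nat i :: rat) = of_int (x' * gcd x (int i)) / of_int (i' * gcd x (int i))"
      using * by simp
    also have "\<dots> = of_int x' / of_int i'" using g by simp
    finally show ?thesis using * i' by (metis dvd_triv_left)
  qed
  obtain x' i' where x': "(of_int x / of_nat i :: rat) = of_int x' / of_int i'" "coprime x' i'"
    "i' > 0" "x' dvd x" "i' dvd int i" using ex[OF assms(1)] by blast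
  obtain z' j' where z': "(of_int z / of_nat j :: rat) = of_int z' / of_int j'" "coprime z' j'"
    "j' > 0" "z' dvd z" "j' dvd int j" using ex[OF assms(2)] by blast
  have "coprime z' i'" "coprime x' j'"
    using coprime_divisors[OF z'(4) x'(5) assms(3)] coprime_divisors[OF x'(4) z'(5) assms(4)] .
  then have "coprime (x' * z') (i' * j')" using x'(2) z'(2) by simp
  then have "denom (of_int (x' * z') / of_int (i' * j')) = i' * j'"
    using x'(3) z'(3) by (intro denom_coprime) auto
  then show ?thesis unfolding no_cancelation_def x'(1) z'(1)
    using x'(2,3) z'(2,3) by (simp add: denom_coprime)
qed

lemma no_cancelation_commute: "no_cancelation x y \<longleftrightarrow> no_cancelation y x"
  by (simp add: no_cancelation_def mult.commute)

lemma mem_frac_Ints_iff: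
  assumes "i > 0" "\<sigma> > 0"
  shows "of_int x / of_nat i \<in> frac_Ints \<sigma> \<longleftrightarrow> int i dvd int \<sigma> * x"
proof
  assume "of_int x / of_nat i \<in> frac_Ints \<sigma>"
  then obtain k :: int where "of_int x / of_nat i = (of_int k / of_nat \<sigma> :: rat)"
    by (auto simp: frac_Ints_def)
  then have "(of_int (int \<sigma> * x) :: rat) = of_int (int i * k)" using assms by (simp add: field_simps)
  then have "int \<sigma> * x = int i * k" by (simp only: of_int_eq_iff)
  then show "int i dvd int \<sigma> * x" by simp
next
  assume "int i dvd int \<sigma> * x"
  then obtain k where "int \<sigma> * x = int i * k" by blast
  then have "(of_int (int \<sigma> * x) :: rat) = of_int (int i * k)" by simp
  then have "of_int x / of_nat i = (of_int k / of_nat \<sigma> :: rat)" using assms by (simp add: field_simps)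
  then show "of_int x / of_nat i \<in> frac_Ints \<sigma>" by (auto simp: frac_Ints_def)
qed

lemma presentation_matrix_eq_star_mat:
  fixes i j g h :: nat and x y z w :: int
  assumes "i > 0" "j > 0" "g > 0"
  shows "(vector [vector [of_rat (of_int x / of_nat i) * sqrt (real (i\<^sup>2 * g)),
              of_rat (of_int z / of_nat j) / sqrt (real (i\<^sup>2 * g))],
            vector [of_rat (of_int w / of_nat j) * (real (i\<^sup>2 * g * (j\<^sup>2 * h)) / real (i\<^sup>2 * g)) * sqrt (real (i\<^sup>2 * g)),
              of_rat (of_int y / of_nat i) * sqrt (real (i\<^sup>2 * g))]] :: real^2^2)
    = star_mat (i * j) g h x y z w"
proof -
  have "sqrt (real (i\<^sup>2 * g)) = real i * sqrt (real g)" by (simp add: real_sqrt_mult)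
  moreover have "real (i\<^sup>2 * g * (j\<^sup>2 * h)) / real (i\<^sup>2 * g) = real j * real j * real h"
    using assms by (simp add: power2_eq_square)
  ultimately show ?thesis unfolding star_mat_def mat2_def[symmetric] mat2_eq_iff
    using assms by (simp add: of_rat_divide field_simps)
qed

text \<open>From a presentation, the conditions for the coprime square parts \<open>i\<close> and
  \<open>j\<close> multiply to one for \<open>s = i * j\<close>. Conversely \<open>\<mu>\<close>
  must be recovered from the matrix, and \<open>x * y * g\<close> decides which primes of
  \<open>N\<close> it receives.\<close>

lemma mem_Gamma0_star_iff:
  fixes N s t \<sigma> :: nat
  assumes "N > 0" "N = s\<^sup>2 * t" "squarefree t" "\<sigma> > 0"
  shows "A \<in> Gamma0_star N \<sigma> \<longleftrightarrow> (\<exists>g h x y z w. g * h = t \<and> x * y * int g - z * w * int h = 1 \<and>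
    A = star_mat s g h x y z w \<and> int s dvd int \<sigma> * (x * z) \<and> int s dvd int \<sigma> * (w * y))"
    (is "?l \<longleftrightarrow> ?r")
proof
  assume ?l
  then obtain \<mu> a b c d where pres: "presentation N A \<mu> a b c d" and
    sub: "{a, b, c, d} \<subseteq> frac_Ints \<sigma>" and carr: "A \<in> carrier SL2R"
    by (auto simp: Gamma0_star_def Gamma0_star_full_def)
  define \<nu> where "\<nu> = N div \<mu>"
  have \<mu>: "\<mu> > 0" "N = \<mu> * \<nu>" "coprime \<mu> \<nu>" using pres by (auto simp: presentation_def \<nu>_def)
  then have \<nu>: "\<nu> > 0" using assms(1) by (auto intro!: gr0I)
  define i j g h where "i = square_part \<mu>" "j = square_part \<nu>" "g = squarefree_part \<mu>"
    "h = squarefree_part \<nu>"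
  note defs = i_j_g_h_def
  have \<mu>i: "\<mu> = i\<^sup>2 * g" and \<nu>j: "\<nu> = j\<^sup>2 * h"
    using squarefree_decompose[of \<mu>] squarefree_decompose[of \<nu>] by (simp_all add: defs mult.commute)
  have ij: "i > 0" "j > 0" "g > 0" "h > 0" using \<mu>(1) \<nu> by (auto simp: \<mu>i \<nu>j)
  have cop: "coprime i j" "coprime g h" using \<mu>(3) ij by (auto simp: \<mu>i \<nu>j)
  have sq: "squarefree (g * h)" using cop(2) by (intro squarefree_mult_coprime) (auto simp: defs)
  have "square_part N = i * j" using ij sq \<mu>(2)
    by (intro square_part_eqI) (auto simp: \<mu>i \<nu>j power_mult_distrib)
  moreover have "square_part N = s" using assms by (intro square_part_eqI) (auto intro!: gr0I)
  ultimately have s: "s = i * j" by simp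
  have t: "g * h = t"
  proof -
    have "(i * j)\<^sup>2 * (g * h) = (i * j)\<^sup>2 * t"
      using assms(2) \<mu>(2) by (simp add: s \<mu>i \<nu>j power_mult_distrib ac_simps)
    then show ?thesis using ij by simp
  qed
  have "a \<in> frac_Ints i" "d \<in> frac_Ints i" "b \<in> frac_Ints j" "c \<in> frac_Ints j"
    using pres by (auto simp: presentation_def defs \<nu>_def)
  then obtain x y z w :: int where xyzw: "a = of_int x / of_nat i" "d = of_int y / of_nat i"
    "b = of_int z / of_nat j" "c = of_int w / of_nat j" by (auto simp: frac_Ints_def)
  have A: "A = star_mat s g h x y z w"
    unfolding s presentation_matrix_eq_star_mat[OF ij(1-3), symmetric]
    using pres by (simp add: presentation_def xyzw \<mu>(2) \<mu>i[symmetric] \<nu>j[symmetric])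
  have "real_of_int (x * y * int g - z * w * int h) = of_int 1"
    using carr ij by (simp add: SL2R_def A det_star_mat s)
  then have det: "x * y * int g - z * w * int h = 1" by (simp only: of_int_eq_iff)
  have "int i dvd int \<sigma> * x" "int i dvd int \<sigma> * y" "int j dvd int \<sigma> * z" "int j dvd int \<sigma> * w"
    using sub unfolding xyzw by (simp_all add: mem_frac_Ints_iff ij assms(4))
  then have "int i dvd int \<sigma> * x * z" "int j dvd int \<sigma> * z * x" "int i dvd int \<sigma> * y * w"
    "int j dvd int \<sigma> * w * y" by (simp_all only: dvd_mult2)
  then have "int i dvd int \<sigma> * (x * z)" "int j dvd int \<sigma> * (x * z)" "int i dvd int \<sigma> * (w * y)"
    "int j dvd int \<sigma> * (w * y)" by (simp_all add: ac_simps)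
  then have "int s dvd int \<sigma> * (x * z)" "int s dvd int \<sigma> * (w * y)"
    using cop(1) by (simp_all add: s divides_mult)
  then show ?r using t det A by blast
next
  assume ?r
  then obtain g h x y z w where gh: "g * h = t" and det: "x * y * int g - z * w * int h = 1" and
    A: "A = star_mat s g h x y z w" and
    \<sigma>: "int s dvd int \<sigma> * (x * z)" "int s dvd int \<sigma> * (w * y)" by blast
  have pos: "s > 0" "g > 0" "h > 0" using assms(1,2) gh by (auto intro!: gr0I)
  have sqf: "squarefree g" "squarefree h" using assms(3) gh by (auto dest: squarefree_multD)
  have carr: "A \<in> carrier SL2R" using pos det by (simp add: SL2R_def A det_star_mat)
  define u where "u = x * y * int g"
  define v where "v = z * w * int h"
  have uv: "coprime u v"
  proof (rule coprimeI)
    fix c assume "c dvd u" "c dvd v"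
    then have "c dvd u - v" by (rule dvd_diff)
    then show "is_unit c" by (simp only: u_def v_def det)
  qed
  text \<open>A presentation is cancelation-free when each prime of \<open>N\<close> dividing \<open>u = xyg\<close> goes to
    \<open>\<mu>\<close> and all others go to \<open>N/\<mu>\<close>.\<close>
  obtain \<mu> \<nu> where \<mu>: "N = \<mu> * \<nu>" "coprime \<mu> \<nu>" "coprime \<nu> (nat \<bar>u\<bar>)"
      "\<And>p. prime p \<Longrightarrow> p dvd \<mu> \<Longrightarrow> p dvd nat \<bar>u\<bar>"
    by (rule ex_coprime_split[OF assms(1), of "nat \<bar>u\<bar>"]) (rule that)
  have \<nu>u: "coprime u (int \<nu>)"
    using \<mu>(3) by (simp add: coprime_commute flip: coprime_int_iff)
  have \<mu>v: "coprime v (int \<mu>)"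
  proof -
    have "coprime \<mu> (nat \<bar>v\<bar>)"
    proof (rule ccontr)
      assume "\<not> coprime \<mu> (nat \<bar>v\<bar>)"
      then have "gcd \<mu> (nat \<bar>v\<bar>) \<noteq> 1" by (simp add: coprime_iff_gcd_eq_1)
      then obtain p where "prime p" "p dvd gcd \<mu> (nat \<bar>v\<bar>)" using prime_factor_nat by blast
      then have p: "prime p" "p dvd \<mu>" "p dvd nat \<bar>v\<bar>"
        by (meson dvd_trans gcd_dvd1 gcd_dvd2)+
      then have "int p dvd u" "int p dvd v" using \<mu>(4)[of p] by (simp_all flip: int_dvd_int_iff)
      then have "is_unit (int p)" using uv coprime_common_divisor by blast
      then show False using p(1) by simp
    qed
    then show ?thesis by (simp add: coprime_commute flip: coprime_int_iff)
  qed
  have \<mu>\<nu>: "\<mu> * \<nu> = s\<^sup>2 * (g * h)" using \<mu>(1) assms(2) gh by simp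
  \<comment> \<open>As \<open>g\<close> divides \<open>u\<close> and \<open>h\<close> divides
    \<open>v\<close>, \<open>g\<close> lies entirely in \<open>\<mu>\<close> and \<open>h\<close> in
    \<open>\<nu>\<close>. What remains is a coprime factorization of \<open>s\<^sup>2\<close>, whose
    factors are squares.\<close>
  have "coprime g \<nu>" using \<nu>u pos by (simp add: u_def)
  moreover have "g dvd \<mu> * \<nu>" unfolding \<mu>\<nu> by simp
  ultimately have "g dvd \<mu>" by (simp add: coprime_dvd_mult_left_iff)
  then obtain \<mu>' where \<mu>': "\<mu> = \<mu>' * g" by (metis dvd_div_mult_self)
  have "coprime h \<mu>" using \<mu>v pos by (simp add: v_def)
  moreover have "h dvd \<mu> * \<nu>" unfolding \<mu>\<nu> by simp
  ultimately have "h dvd \<nu>" by (simp add: coprime_dvd_mult_right_iff)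
  then obtain \<nu>' where \<nu>': "\<nu> = \<nu>' * h" by (metis dvd_div_mult_self)
  have "\<mu>' * \<nu>' * (g * h) = s\<^sup>2 * (g * h)" using \<mu>\<nu> unfolding \<mu>' \<nu>'
    by (simp only: ac_simps)
  then have "\<mu>' * \<nu>' = s\<^sup>2" using pos by simp
  moreover have "coprime \<mu>' \<nu>'" using \<mu>(2) by (simp add: \<mu>' \<nu>')
  ultimately have "is_nth_power 2 \<mu>'" "is_nth_power 2 \<nu>'"
    using is_nth_power_mult_coprime_nat_iff[of \<mu>' \<nu>' 2] by auto
  then obtain i j where ij: "\<mu>' = i\<^sup>2" "\<nu>' = j\<^sup>2" by (auto simp: is_nth_power_def)
  have "(i * j)\<^sup>2 = s\<^sup>2" using \<open>\<mu>' * \<nu>' = s\<^sup>2\<close> by (simp add: ij power_mult_distrib)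
  then have s: "s = i * j" by (metis power2_eq_iff_nonneg zero_le)
  have posij: "i > 0" "j > 0" using pos(1) by (auto simp: s)
  have \<mu>i: "\<mu> = i\<^sup>2 * g" and \<nu>j: "\<nu> = j\<^sup>2 * h" by (simp_all add: \<mu>' \<nu>' ij)
  have sp: "square_part \<mu> = i" "square_part \<nu> = j"
    using square_part_eqI[OF posij(1) sqf(1) \<mu>i] square_part_eqI[OF posij(2) sqf(2) \<nu>j] .
  have cop: "coprime z (int i)" "coprime w (int i)" "coprime x (int j)" "coprime y (int j)"
    using \<nu>u \<mu>v pos posij by (simp_all add: u_def v_def \<mu>i \<nu>j)
  let ?a = "of_int x / of_nat i :: rat" and ?b = "of_int z / of_nat j :: rat"
    and ?c = "of_int w / of_nat j :: rat" and ?d = "of_int y / of_nat i :: rat"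
  have \<mu>0: "\<mu> > 0" using posij pos by (simp add: \<mu>i)
  have frac: "of_int k / of_nat n \<in> frac_Ints n" for k n by (auto simp: frac_Ints_def)
  have "N div \<mu> = \<nu>" using \<mu>(1) \<mu>0 by simp
  then have pres: "presentation N A \<mu> ?a ?b ?c ?d"
    unfolding presentation_def A s presentation_matrix_eq_star_mat[OF posij pos(2), symmetric]
    using \<mu>0 \<mu>(1,2) by (simp add: sp frac) (simp add: \<mu>i \<nu>j)
  have free: "cancelation_free ?a ?b ?c ?d"
    unfolding cancelation_free_def no_cancelation_commute[of ?b ?d] no_cancelation_commute[of ?c ?d]
    using cop posij by (simp add: no_cancelation_of_coprime)
  \<comment> \<open>Since \<open>i\<close> is prime to \<open>z\<close>, \<open>w\<close> and
    \<open>j\<close> to \<open>x\<close>, \<open>y\<close>, the conditions on products split into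
    conditions on the single entries.\<close>
  have "int i dvd int \<sigma> * x * z" "int i dvd int \<sigma> * y * w"
    "int j dvd int \<sigma> * z * x" "int j dvd int \<sigma> * w * y"
    using \<sigma> by (auto simp: s ac_simps dest: dvd_mult_left dvd_mult_right)
  then have "int i dvd int \<sigma> * x" "int i dvd int \<sigma> * y" "int j dvd int \<sigma> * z" "int j dvd int \<sigma> * w"
    using cop by (simp_all add: coprime_dvd_mult_left_iff coprime_commute)
  then have "{?a, ?b, ?c, ?d} \<subseteq> frac_Ints \<sigma>" by (simp add: mem_frac_Ints_iff posij assms(4))
  then show ?l using pres free carr unfolding Gamma0_star_def Gamma0_star_full_def by blast
qed

theorem theorem3p1:
  fixes N D :: nat
  assumes "N > 0" and "D dvd N"
  shows "normalizer SL2R (Gamma01 N D) = Gamma0_star N (star_sigma N D)"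
proof (rule Set.set_eqI)
  fix A
  define s where "s = square_part N"
  define t where "t = squarefree_part N"
  have N: "N = s\<^sup>2 * t" using squarefree_decompose[of N] by (simp add: s_def t_def mult.commute)
  have t: "squarefree t" by (simp add: t_def)
  have "s > 0" using assms(1) by (metis s_def gr0I not_less0 square_part_0_iff)
  then have \<sigma>: "star_sigma N D > 0" using sigma_dvd[OF assms] by (auto simp: s_def intro!: gr0I)
  have iff: "star_mat s g h x y z w \<in> normalizer SL2R (Gamma01 N D) \<longleftrightarrow>
      int s dvd int (star_sigma N D) * (x * z) \<and> int s dvd int (star_sigma N D) * (w * y)"
    if "g * h = t" "x * y * int g - z * w * int h = 1" for g h x y z w
    by (rule star_mat_mem_normalizer_iff[OF assms s_def _ that(2)]) (simp only: that(1) N[symmetric])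
  show "A \<in> normalizer SL2R (Gamma01 N D) \<longleftrightarrow> A \<in> Gamma0_star N (star_sigma N D)"
    unfolding mem_Gamma0_star_iff[OF assms(1) N t \<sigma>]
  proof
    assume A: "A \<in> normalizer SL2R (Gamma01 N D)"
    obtain g h x y z w where *: "g * h = t" "x * y * int g - z * w * int h = 1"
      and "A = star_mat s g h x y z w"
      using A by (rule normalizer_imp_star_mat[OF assms N t])
    moreover from A have "int s dvd int (star_sigma N D) * (x * z) \<and>
      int s dvd int (star_sigma N D) * (w * y)" unfolding \<open>A = _\<close> iff[OF *] .
    ultimately show "\<exists>g h x y z w. g * h = t \<and> x * y * int g - z * w * int h = 1 \<and>
      A = star_mat s g h x y z w \<and> int s dvd int (star_sigma N D) * (x * z) \<and>
      int s dvd int (star_sigma N D) * (w * y)"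
      by (intro exI[of _ g] exI[of _ h] exI[of _ x] exI[of _ y] exI[of _ z] exI[of _ w] conjI) auto
  next
    assume "\<exists>g h x y z w. g * h = t \<and> x * y * int g - z * w * int h = 1 \<and>
      A = star_mat s g h x y z w \<and> int s dvd int (star_sigma N D) * (x * z) \<and>
      int s dvd int (star_sigma N D) * (w * y)"
    then obtain g h x y z w where "g * h = t" "x * y * int g - z * w * int h = 1"
      "A = star_mat s g h x y z w" "int s dvd int (star_sigma N D) * (x * z)"
      "int s dvd int (star_sigma N D) * (w * y)" by blast
    then show "A \<in> normalizer SL2R (Gamma01 N D)" by (simp only: iff)
  qed
qed

end
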